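(* Let $(X_0,X_1)$ and $(Y_0,Y_1)$ be regular interpolation pairs of Köthe spaces with $[X_0,X_1]_{1/2}=[Y_0,Y_1]_{1/2}$, with differentials at $1/2$ denoted $\Omega_X$ and $\Omega_Y$. Consider the arcs $A_0=\{e^{it}:0<t<\pi/2\}$, $A_{\pi/2}=\{e^{it}:\pi/2<t<\pi\}$, $A_\pi=\{e^{it}:\pi<t<3\pi/2\}$, $A_{3\pi/2}=\{e^{it}:3\pi/2<t<2\pi\}$, and complex interpolation at $z=0$ of families of four spaces placed on them. (1) The family with $Y_0$ on $A_0$, $X_0$ on $A_{\pi/2}$, $Y_1$ on $A_\pi$, $X_1$ on $A_{3\pi/2}$ generates at $0$ a centralizer projectively equivalent to $\Omega_X+i\Omega_Y$ (namely $\varphi'_{A_{3\pi/2}}(0)(\Omega_X+i\Omega_Y)$). Interchanging $Y_0$ and $Y_1$ one obtains $\Omega_X-i\Omega_Y$; interchanging $X_0$ and $X_1$ one obtains $-\Omega_X+i\Omega_Y$; interchanging both one obtains $-\Omega_X-i\Omega_Y$; and interchanging the roles of $X_0,X_1$ with $Y_0,Y_1$ (i.e. $X_0$ on $A_0$, $Y_0$ on $A_{\pi/2}$, $X_1$ on $A_\pi$, $Y_1$ on $A_{3\pi/2}$) one obtains $i\Omega_X+\Omega_Y$ (all up to the same nonzero factor $\varphi'_{A_{3\pi/2}}(0)$, hence up to projective equivalence). (2) The centralizer $\Omega_X+\Omega_Y$ is projectively equivalent to the centralizer generated at $0$ by the family with $[X_0,Y_0]_{1/2}$ on $A_+=\{e^{it}:0<t<\pi\}$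 and $[X_1,Y_1]_{1/2}$ on $A_-=\{e^{it}:\pi<t<2\pi\}$.
   Context: Köthe spaces over a common $\sigma$-finite measure space; regular pair: intersection dense in both spaces; $[A,B]_{1/2}=A^{1/2}B^{1/2}$ with differential $x\mapsto x\log(|b(x)|/|a(x)|)$ for almost optimal factorizations $|x|=|a(x)|^{1/2}|b(x)|^{1/2}$. For a family with spaces $X(j)$ on arcs $A_j$ of the unit circle, the interpolation space at $0$ is $\prod X(j)^{\mu_0(A_j)}$ ($\mu_0$ normalized arc length) and its differential at $0$ is $x\mapsto x\sum_j\varphi_{A_j}'(0)\log|a_j(x)|$, where $|x|=\prod|a_j(x)|^{\mu_0(A_j)}$ is an almost optimal factorization and $\varphi_A$ is analytic on the unit disk with $\mathrm{Re}\,\varphi_A=\chi_A$ on $\mathbb T$. A centralizer $\Omega$ is trivial if $\Omega-L$ is a bounded map into the space for some linear $L$; $\Omega,\Psi$ are projectively equivalent if $\Omega-c\Psi$ is trivial for some scalar $c\neq0$. *)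

theory Defs
  imports "HOL-Analysis.Analysis"
begin

text \<open>Koethe function spaces over a measure space M are represented by their
(extended) norm functional N on complex-valued functions; the space itself is
the set of measurable functions of finite norm.\<close>

type_synonym 'a kfun = "'a \<Rightarrow> complex"
type_synonym 'a knorm = "'a kfun \<Rightarrow> ennreal"

definition kspace :: "'a measure \<Rightarrow> 'a knorm \<Rightarrow> 'a kfun set" where
  "kspace M N = {f \<in> borel_measurable M. N f < top}"

definition kothe :: "'a measure \<Rightarrow> 'a knorm \<Rightarrow> bool" where
  "kothe M N \<longleftrightarrow>
     (\<forall>f \<in> borel_measurable M. N f = 0 \<longleftrightarrow> (AE t in M. f t = 0)) \<and>
     (\<forall>f \<in> borel_measurable M. \<forall>c. N (\<lambda>t. c * f t) = ennreal (cmod c) * N f) \<and>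
     (\<forall>f \<in> borel_measurable M. \<forall>g \<in> borel_measurable M. N (\<lambda>t. f t + g t) \<le> N f + N g) \<and>
     (\<forall>f \<in> borel_measurable M. \<forall>g \<in> borel_measurable M.
        (AE t in M. cmod (f t) \<le> cmod (g t)) \<longrightarrow> N f \<le> N g) \<and>
     (\<forall>F :: nat \<Rightarrow> 'a kfun. (\<forall>n. F n \<in> kspace M N) \<and>
        (\<forall>e>0. \<exists>m. \<forall>n\<ge>m. \<forall>k\<ge>m. N (\<lambda>t. F n t - F k t) < ennreal e) \<longrightarrow>
        (\<exists>f \<in> kspace M N. ((\<lambda>n. N (\<lambda>t. F n t - f t)) \<longlonglongrightarrow> 0))) \<and>
     (\<exists>w \<in> kspace M N. AE t in M. w t \<noteq> 0)"

definition regular_pair :: "'a measure \<Rightarrow> 'a knorm \<Rightarrow> 'a knorm \<Rightarrow> bool" where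
  "regular_pair M X0 X1 \<longleftrightarrow>
     (\<forall>f \<in> kspace M X0. \<forall>e>0. \<exists>g \<in> kspace M X0 \<inter> kspace M X1. X0 (\<lambda>t. f t - g t) < ennreal e) \<and>
     (\<forall>f \<in> kspace M X1. \<forall>e>0. \<exists>g \<in> kspace M X0 \<inter> kspace M X1. X1 (\<lambda>t. f t - g t) < ennreal e)"

definition calderon :: "'a measure \<Rightarrow> 'j set \<Rightarrow> ('j \<Rightarrow> real) \<Rightarrow> ('j \<Rightarrow> 'a knorm) \<Rightarrow> 'a knorm" where
  "calderon M J \<theta> Ns f =
     (INF l \<in> {l::real. l \<ge> 0 \<and> (\<exists>as :: 'j \<Rightarrow> 'a kfun.
          (\<forall>j\<in>J. as j \<in> borel_measurable M \<and> Ns j (as j) \<le> 1) \<and>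
          (AE t in M. cmod (f t) \<le> l * (\<Prod>j\<in>J. cmod (as j t) powr \<theta> j)))}. ennreal l)"

definition aof :: "'a measure \<Rightarrow> 'j set \<Rightarrow> ('j \<Rightarrow> real) \<Rightarrow> ('j \<Rightarrow> 'a knorm)
                   \<Rightarrow> ('j \<Rightarrow> 'a kfun \<Rightarrow> 'a kfun) \<Rightarrow> bool" where
  "aof M J \<theta> Ns as \<longleftrightarrow> (\<exists>C::real. \<forall>x \<in> kspace M (calderon M J \<theta> Ns).
      (\<forall>j\<in>J. as j x \<in> borel_measurable M \<and> Ns j (as j x) \<le> ennreal C * calderon M J \<theta> Ns x) \<and>
      (AE t in M. cmod (x t) = (\<Prod>j\<in>J. cmod (as j x t) powr \<theta> j)))"

text \<open>Two-space case: A^{1/2} B^{1/2} = [A,B]_{1/2} and its differential.\<close>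
definition pair_norm :: "'a measure \<Rightarrow> 'a knorm \<Rightarrow> 'a knorm \<Rightarrow> 'a knorm" where
  "pair_norm M A B = calderon M {0::nat, 1} (\<lambda>_. 1/2) (\<lambda>j. if j = 0 then A else B)"

definition pair_aof :: "'a measure \<Rightarrow> 'a knorm \<Rightarrow> 'a knorm
                        \<Rightarrow> ('a kfun \<Rightarrow> 'a kfun) \<Rightarrow> ('a kfun \<Rightarrow> 'a kfun) \<Rightarrow> bool" where
  "pair_aof M A B a b = aof M {0::nat, 1} (\<lambda>_. 1/2) (\<lambda>j. if j = 0 then A else B)
                           (\<lambda>j. if j = 0 then a else b)"

definition pair_diff :: "('a kfun \<Rightarrow> 'a kfun) \<Rightarrow> ('a kfun \<Rightarrow> 'a kfun) \<Rightarrow> 'a kfun \<Rightarrow> 'a kfun" where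
  "pair_diff a b x = (\<lambda>t. x t * complex_of_real (ln (cmod (b x t) / cmod (a x t))))"

definition arc :: "real \<Rightarrow> real \<Rightarrow> complex set" where
  "arc s u = cis ` {s<..<u}"

definition mu0 :: "complex set \<Rightarrow> real" where
  "mu0 A = measure lborel {t \<in> {0..<2*pi}. cis t \<in> A} / (2*pi)"

definition is_phi :: "complex set \<Rightarrow> (complex \<Rightarrow> complex) \<Rightarrow> bool" where
  "is_phi A \<phi> \<longleftrightarrow> \<phi> holomorphic_on ball 0 1 \<and> bounded (Re ` \<phi> ` ball 0 1) \<and>
     (AE t in lborel. t \<in> {0..2*pi} \<longrightarrow>
        ((\<lambda>r. Re (\<phi> (complex_of_real r * cis t))) \<longlongrightarrow> indicator A (cis t)) (at_left 1))"

definition dphi :: "complex set \<Rightarrow> complex" where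
  "dphi A = deriv (SOME \<phi>. is_phi A \<phi>) 0"

text \<open>Interpolation of a family X(j) on arcs arc j at z = 0: the space
 \<Prod> X(j)^{mu0(arc j)} and the differential x \<mapsto> x \<Sum> \<phi>'_{arc j}(0) log|a_j(x)|.\<close>
definition fam_norm :: "'a measure \<Rightarrow> 'j set \<Rightarrow> ('j \<Rightarrow> complex set) \<Rightarrow> ('j \<Rightarrow> 'a knorm) \<Rightarrow> 'a knorm" where
  "fam_norm M J arcs Ns = calderon M J (\<lambda>j. mu0 (arcs j)) Ns"

definition fam_aof :: "'a measure \<Rightarrow> 'j set \<Rightarrow> ('j \<Rightarrow> complex set) \<Rightarrow> ('j \<Rightarrow> 'a knorm)
                       \<Rightarrow> ('j \<Rightarrow> 'a kfun \<Rightarrow> 'a kfun) \<Rightarrow> bool" where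
  "fam_aof M J arcs Ns as = aof M J (\<lambda>j. mu0 (arcs j)) Ns as"

definition fam_diff :: "'j set \<Rightarrow> ('j \<Rightarrow> complex set) \<Rightarrow> ('j \<Rightarrow> 'a kfun \<Rightarrow> 'a kfun) \<Rightarrow> 'a kfun \<Rightarrow> 'a kfun" where
  "fam_diff J arcs as x =
     (\<lambda>t. x t * (\<Sum>j\<in>J. dphi (arcs j) * complex_of_real (ln (cmod (as j x t)))))"

definition trivial :: "'a measure \<Rightarrow> 'a knorm \<Rightarrow> ('a kfun \<Rightarrow> 'a kfun) \<Rightarrow> bool" where
  "trivial M N \<Omega> \<longleftrightarrow> (\<exists>L :: 'a kfun \<Rightarrow> 'a kfun.
     (\<forall>x \<in> kspace M N. \<forall>y \<in> kspace M N. \<forall>\<alpha> \<beta>.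
        AE t in M. L (\<lambda>s. \<alpha> * x s + \<beta> * y s) t = \<alpha> * L x t + \<beta> * L y t) \<and>
     (\<exists>K::real. \<forall>x \<in> kspace M N. (\<lambda>t. \<Omega> x t - L x t) \<in> kspace M N \<and>
        N (\<lambda>t. \<Omega> x t - L x t) \<le> ennreal K * N x))"

definition proj_equiv :: "'a measure \<Rightarrow> 'a knorm \<Rightarrow> ('a kfun \<Rightarrow> 'a kfun) \<Rightarrow> ('a kfun \<Rightarrow> 'a kfun) \<Rightarrow> bool" where
  "proj_equiv M N \<Omega> \<Psi> \<longleftrightarrow> (\<exists>c::complex. c \<noteq> 0 \<and> trivial M N (\<lambda>x t. \<Omega> x t - c * \<Psi> x t))"

definition fam_generates :: "'a measure \<Rightarrow> 'j set \<Rightarrow> ('j \<Rightarrow> complex set) \<Rightarrow> ('j \<Rightarrow> 'a knorm)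
                             \<Rightarrow> 'a knorm \<Rightarrow> complex \<Rightarrow> ('a kfun \<Rightarrow> 'a kfun) \<Rightarrow> bool" where
  "fam_generates M J arcs Ns Z c \<Psi> \<longleftrightarrow> (\<forall>as. fam_aof M J arcs Ns as \<longrightarrow>
      kspace M (fam_norm M J arcs Ns) = kspace M Z \<and>
      trivial M Z (\<lambda>x t. fam_diff J arcs as x t - c * \<Psi> x t))"

definition A4 :: "nat \<Rightarrow> complex set" where
  "A4 j = arc (real j * pi / 2) (real (j + 1) * pi / 2)"

definition A2 :: "nat \<Rightarrow> complex set" where
  "A2 j = arc (real j * pi) (real (j + 1) * pi)"

definition sel4 :: "'b \<Rightarrow> 'b \<Rightarrow> 'b \<Rightarrow> 'b \<Rightarrow> nat \<Rightarrow> 'b" where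
  "sel4 a b c d j = (if j = 0 then a else if j = 1 then b else if j = 2 then c else d)"

end

theory Submission
  imports Defs "HOL-Complex_Analysis.Cauchy_Integral_Formula"
begin

text \<open>
  The derivative at 0 of a holomorphic function is a Fourier coefficient of the boundary values of
  its real part, and for an arc the function is an explicit difference of logarithms; the four
  quarter arcs therefore have derivatives proportional to the powers of \<open>- \<i>\<close>.

  Two almost optimal factorizations of \<open>x\<close> define differentials at bounded distance: if \<open>c\<^sub>j\<close> is the
  larger of the two \<open>j\<close>-th factors, then the product of the \<open>c\<^sub>j\<close> dominates \<open>x\<close> times the difference
  of the logarithms. So the differential of a family may be computed from any convenient
  factorization, and the given factorizations of \<open>x\<close> for the two pairs combine to one for the
  family, because \<open>\<bar>x\<bar>\<close> is the geometric mean of \<open>\<bar>x\<bar>\<close> and \<open>\<bar>x\<bar>\<close>. That it is almost optimal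
  requires the norms of the two equal spaces to be equivalent. If they were not, a sequence with
  rapidly decreasing norm in one space and unbounded norm in the other would be dominated by a single
  element of the first space, obtained by summing the factors separately.
\<close>

section \<open>The functions \<open>\<phi>\<close> of arcs\<close>

text \<open>The algebra of the statement sits in the coefficients. Opposite quarter arcs have
  opposite derivatives, so the logarithms of the factors of two spaces on opposite arcs combine into
  the logarithm of a quotient, which is the differential of that pair. Passing to the adjacent arc
  multiplies by \<open>- \<i>\<close>, which puts \<open>\<i>\<close> in front of one of the two
  pairs. Exchanging the two spaces of a pair reverses the sign of its differential, so all five
  placements are instances of one statement about pairs \<open>U\<close> and \<open>V\<close>.

  On the half arcs the two spaces are products themselves and their factors are geometric means.
  These halve the logarithms, and this fixes the constant of the projective equivalence.

  In every case the difference of the differentials is itself bounded, so the linear map demanded by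
  triviality is 0. Since \<open>dphi\<close> is defined by a choice of function, the explicit
  functions of arcs become usable only through a uniqueness argument for the derivative.\<close>

lemma has_integral_Re_circle_deriv:
  fixes g :: "complex \<Rightarrow> complex"
  assumes hol: "g holomorphic_on ball 0 1" and r: "0 < r" "r < 1"
  shows "((\<lambda>t. complex_of_real (Re (g (complex_of_real r * cis t))) * cis (- t))
           has_integral (pi * r * deriv g 0)) {0..2*pi}"
proof -
  have sub: "cball 0 r \<subseteq> ball (0::complex) 1" "ball 0 r \<subseteq> ball (0::complex) 1"
    using r by auto
  have cont: "continuous_on (cball 0 r) g"
    by (rule holomorphic_on_imp_continuous_on[OF holomorphic_on_subset[OF hol sub(1)]])
  have hol': "g holomorphic_on ball 0 r"
    by (rule holomorphic_on_subset[OF hol sub(2)])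
  have "((\<lambda>u. g u / u\<^sup>2) has_contour_integral (2 * pi * \<i> * deriv g 0)) (circlepath 0 r)"
    using Cauchy_has_contour_integral_higher_derivative_circlepath[OF cont hol', of 0 1] r
    by (simp add: power2_eq_square)
  hence "((\<lambda>t. g (of_real r * cis t) / (of_real r * cis t)\<^sup>2 * r * \<i> * cis t)
            has_integral (2 * pi * \<i> * deriv g 0)) {0..2*pi}"
    unfolding circlepath_def by (subst (asm) has_contour_integral_part_circlepath_iff) auto
  from has_integral_mult_right[OF this, of "of_real r / (2 * \<i>)"]
  have "((\<lambda>t. of_real r / (2 * \<i>) * (g (of_real r * cis t) / (of_real r * cis t)\<^sup>2 * r * \<i> * cis t))
            has_integral (pi * r * deriv g 0)) {0..2*pi}"
    by (simp add: field_simps)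
  also have "(\<lambda>t. of_real r / (2 * \<i>) * (g (of_real r * cis t) / (of_real r * cis t)\<^sup>2 * r * \<i> * cis t))
             = (\<lambda>t. g (of_real r * cis t) * cis (- t) / 2)"
    using r by (auto simp: fun_eq_iff power2_eq_square field_simps cis_mult simp flip: cis_inverse)
  finally have 1: "((\<lambda>t. g (of_real r * cis t) * cis (- t) / 2) has_integral (pi * r * deriv g 0)) {0..2*pi}" .
  \<comment> \<open>Since \<open>Re g\<close> is half the sum of \<open>g\<close> and
    \<open>cnj g\<close>, the conjugate part has to vanish: its integral against
    \<open>cis (- t)\<close> is the conjugate of that of \<open>g\<close> against
    \<open>cis t\<close>, which is 0 by Cauchy's theorem.\<close>
  have "(g has_contour_integral 0) (circlepath 0 r)"
    by (rule Cauchy_theorem_disc_simple[OF hol]) (use r in auto)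
  hence "((\<lambda>t. g (of_real r * cis t) * r * \<i> * cis t) has_integral 0) {0..2*pi}"
    unfolding circlepath_def by (subst (asm) has_contour_integral_part_circlepath_iff) auto
  from has_integral_linear[OF has_integral_mult_right[OF this, of "1 / (2 * \<i> * of_real r)"] bounded_linear_cnj]
  have "((\<lambda>t. cnj (1 / (2 * \<i> * of_real r) * (g (of_real r * cis t) * r * \<i> * cis t))) has_integral 0) {0..2*pi}"
    by (simp add: o_def)
  also have "(\<lambda>t. cnj (1 / (2 * \<i> * of_real r) * (g (of_real r * cis t) * r * \<i> * cis t)))
             = (\<lambda>t. cnj (g (of_real r * cis t)) * cis (- t) / 2)"
  proof
    fix t
    have e: "1 / (2 * \<i> * of_real r) * (g (of_real r * cis t) * r * \<i> * cis t) = g (of_real r * cis t) * cis t / 2"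
      using r by (simp add: field_simps)
    show "cnj (1 / (2 * \<i> * of_real r) * (g (of_real r * cis t) * r * \<i> * cis t))
        = cnj (g (of_real r * cis t)) * cis (- t) / 2"
      unfolding e by (simp add: cis_cnj)
  qed
  finally have 2: "((\<lambda>t. cnj (g (of_real r * cis t)) * cis (- t) / 2) has_integral 0) {0..2*pi}" .
  have eq: "g w * c / 2 + cnj (g w) * c / 2 = of_real (Re (g w)) * c" for w c
    by (simp add: complex_eq_iff field_simps)
  show ?thesis
    using has_integral_add[OF 1 2] unfolding eq by simp
qed

lemma bounded_Re_image_iff: "bounded (Re ` g ` A) \<longleftrightarrow> (\<exists>B. \<forall>z\<in>A. \<bar>Re (g z)\<bar> \<le> B)"
  by (simp add: bounded_iff)

text \<open>The bound on the real part is a constant majorant on the circles, so dominated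
  convergence carries the integral formula for the derivative to the boundary values.\<close>

lemma deriv_0_eq_0_if_radial_Re_limit_0:
  assumes hol: "g holomorphic_on ball 0 1"
    and bdd: "bounded (Re ` g ` ball 0 1)"
    and lim: "AE t in lborel. t \<in> {0..2*pi} \<longrightarrow>
        ((\<lambda>r. Re (g (complex_of_real r * cis t))) \<longlongrightarrow> 0) (at_left 1)"
  shows "deriv g 0 = 0"
proof -
  obtain B where B: "\<And>z. z \<in> ball 0 1 \<Longrightarrow> \<bar>Re (g z)\<bar> \<le> B"
    using bdd unfolding bounded_Re_image_iff by blast
  \<comment> \<open>Dominated convergence wants a sequence of radii. The shift by 2 starts it at
    1/2, so that every radius is positive.\<close>
  define r where "r n = 1 - 1 / real (n + 2)" for n
  have r: "0 < r n" "r n < 1" for n by (auto simp: r_def field_simps)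
  have "r \<longlonglongrightarrow> 1 - 0"
    unfolding r_def by (intro tendsto_diff tendsto_const LIMSEQ_ignore_initial_segment[OF lim_1_over_n])
  hence r1: "r \<longlonglongrightarrow> 1" by simp
  have rlim: "filterlim r (at_left 1) sequentially"
    unfolding filterlim_at using r r1 by (auto intro!: always_eventually simp: less_imp_neq)
  define f where "f n t = complex_of_real (Re (g (complex_of_real (r n) * cis t))) * cis (- t)" for n t
  have in_ball: "complex_of_real (r n) * cis t \<in> ball 0 1" for n t
    using r[of n] by (simp add: norm_mult)
  have cont: "continuous_on {0..2*pi} (f n)" for n
    unfolding f_def
    by (intro continuous_intros continuous_on_compose2[OF holomorphic_on_imp_continuous_on[OF hol]])
       (use in_ball in auto)
  have int: "set_integrable lborel {0..2*pi} (f n)" for n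
    using cont by (rule borel_integrable_atLeastAtMost')
  have val: "(LINT t:{0..2*pi}|lborel. f n t) = pi * r n * deriv g 0" for n
  proof -
    have "(f n has_integral (pi * r n * deriv g 0)) {0..2*pi}"
      using has_integral_Re_circle_deriv[OF hol r, of n] by (simp add: f_def[abs_def])
    thus ?thesis
      using set_borel_integral_eq_integral(2)[OF int[of n]] by (simp add: integral_unique)
  qed
  have "(\<lambda>n. LINT t|lborel. indicator {0..2*pi} t *\<^sub>R f n t) \<longlonglongrightarrow> (LINT t|(lborel :: real measure). (0::complex))"
  proof (rule integral_dominated_convergence[where w = "\<lambda>t. indicator {0..2*pi} t *\<^sub>R B"])
    show "(\<lambda>t. indicator {0..2*pi} t *\<^sub>R f n t) \<in> borel_measurable lborel" for n
      using int[of n] by (auto simp: set_integrable_def)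
    show "integrable lborel (\<lambda>t. indicator {0..2*pi} t *\<^sub>R B)"
      using borel_integrable_atLeastAtMost'[of 0 "2*pi" "\<lambda>_. B"] by (simp add: set_integrable_def)
    show "AE t in lborel. norm (indicator {0..2*pi} t *\<^sub>R f n t) \<le> indicator {0..2*pi} t *\<^sub>R B" for n
      using B in_ball by (auto simp: f_def norm_mult indicator_def)
    show "AE t in lborel. (\<lambda>n. indicator {0..2*pi} t *\<^sub>R f n t) \<longlonglongrightarrow> 0"
      using lim
    proof eventually_elim
      case (elim t)
      show ?case
      proof (cases "t \<in> {0..2*pi}")
        case True
        with elim have "((\<lambda>r. Re (g (complex_of_real r * cis t))) \<longlongrightarrow> 0) (at_left 1)" by simp
        from filterlim_compose[OF this rlim]
        have "(\<lambda>n. f n t) \<longlonglongrightarrow> complex_of_real 0 * cis (- t)"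
          unfolding f_def by (intro tendsto_mult tendsto_of_real tendsto_const)
        thus ?thesis using True by simp
      qed simp
    qed
  qed simp
  hence "(\<lambda>n. pi * r n * deriv g 0) \<longlonglongrightarrow> 0"
    using val by (simp add: set_lebesgue_integral_def)
  moreover have "(\<lambda>n. complex_of_real (pi * r n) * deriv g 0) \<longlonglongrightarrow> of_real (pi * 1) * deriv g 0"
    by (intro tendsto_intros r1)
  ultimately have "of_real (pi * 1) * deriv g 0 = 0"
    by (metis (no_types, lifting) LIMSEQ_unique of_real_mult)
  thus ?thesis by simp
qed

text \<open>The function itself is determined only up to an imaginary constant, which the derivative
  does not see. This makes \<open>dphi\<close> independent of the choice in its definition.\<close>

lemma is_phi_deriv_unique:
  assumes "is_phi A \<phi>" "is_phi A \<psi>"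
  shows "deriv \<phi> 0 = deriv \<psi> 0"
proof -
  have hol: "\<phi> holomorphic_on ball 0 1" "\<psi> holomorphic_on ball 0 1"
    using assms by (auto simp: is_phi_def)
  have "deriv (\<lambda>z. \<phi> z - \<psi> z) 0 = 0"
  proof (rule deriv_0_eq_0_if_radial_Re_limit_0)
    show "(\<lambda>z. \<phi> z - \<psi> z) holomorphic_on ball 0 1"
      by (intro holomorphic_intros hol)
    obtain B C where "\<And>z. z \<in> ball 0 1 \<Longrightarrow> \<bar>Re (\<phi> z)\<bar> \<le> B" "\<And>z. z \<in> ball 0 1 \<Longrightarrow> \<bar>Re (\<psi> z)\<bar> \<le> C"
      using assms unfolding is_phi_def bounded_Re_image_iff by blast
    hence "\<bar>Re (\<phi> z - \<psi> z)\<bar> \<le> B + C" if "z \<in> ball 0 1" for z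
      using that by (smt (verit) minus_complex.sel(1))
    thus "bounded (Re ` (\<lambda>z. \<phi> z - \<psi> z) ` ball 0 1)"
      unfolding bounded_Re_image_iff by (intro exI[of _ "B + C"]) auto
    have "AE t in lborel. t \<in> {0..2*pi} \<longrightarrow>
        ((\<lambda>r. Re (\<phi> (complex_of_real r * cis t))) \<longlongrightarrow> indicator A (cis t)) (at_left 1)"
      "AE t in lborel. t \<in> {0..2*pi} \<longrightarrow>
        ((\<lambda>r. Re (\<psi> (complex_of_real r * cis t))) \<longlongrightarrow> indicator A (cis t)) (at_left 1)"
      using assms by (auto simp: is_phi_def)
    thus "AE t in lborel. t \<in> {0..2*pi} \<longrightarrow>
        ((\<lambda>r. Re (\<phi> (complex_of_real r * cis t) - \<psi> (complex_of_real r * cis t))) \<longlongrightarrow> 0) (at_left 1)"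
    proof eventually_elim
      case (elim t)
      show ?case
      proof
        assume "t \<in> {0..2*pi}"
        with elim show "((\<lambda>r. Re (\<phi> (complex_of_real r * cis t) - \<psi> (complex_of_real r * cis t))) \<longlongrightarrow> 0) (at_left 1)"
          using tendsto_diff by fastforce
      qed
    qed
  qed
  moreover have "deriv (\<lambda>z. \<phi> z - \<psi> z) 0 = deriv \<phi> 0 - deriv \<psi> 0"
    using hol by (intro deriv_diff) (auto simp: holomorphic_on_open field_differentiable_def)
  ultimately show ?thesis by simp
qed

section \<open>Arguments of chords and the explicit function of an arc\<close>

text \<open>Polar form of the chord from \<open>cis \<alpha>\<close> to 1. For
  \<open>0 < \<alpha> < 2 * pi\<close> the sine is positive and the angle of the second factor lies
  in the principal range, so it is the imaginary part of the logarithm.\<close>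

lemma one_minus_cis: "1 - cis \<alpha> = complex_of_real (2 * sin (\<alpha> / 2)) * cis ((\<alpha> - pi) / 2)"
proof -
  have 1: "cos \<alpha> = 1 - 2 * (sin (\<alpha> / 2))\<^sup>2" "sin \<alpha> = 2 * sin (\<alpha> / 2) * cos (\<alpha> / 2)"
    using cos_double_sin[of "\<alpha> / 2"] sin_double[of "\<alpha> / 2"] by simp_all
  have 2: "cos ((\<alpha> - pi) / 2) = sin (\<alpha> / 2)" "sin ((\<alpha> - pi) / 2) = - cos (\<alpha> / 2)"
    by (simp_all add: diff_divide_distrib cos_diff sin_diff)
  show ?thesis
    by (simp add: complex_eq_iff 1 2 power2_eq_square)
qed

lemma Im_Ln_one_minus_cis:
  assumes "0 < \<alpha>" "\<alpha> < 2 * pi"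
  shows "Im (Ln (1 - cis \<alpha>)) = (\<alpha> - pi) / 2"
proof -
  have s: "0 < sin (\<alpha> / 2)" using assms by (intro sin_gt_zero) auto
  have "exp (complex_of_real (ln (2 * sin (\<alpha> / 2))) + \<i> * of_real ((\<alpha> - pi) / 2)) = 1 - cis \<alpha>"
    unfolding exp_add exp_of_real cis_conv_exp[symmetric] one_minus_cis using s by simp
  hence "Ln (1 - cis \<alpha>) = complex_of_real (ln (2 * sin (\<alpha> / 2))) + \<i> * of_real ((\<alpha> - pi) / 2)"
    by (rule Ln_unique) (use assms in auto)
  thus ?thesis by simp
qed

lemma Im_Ln_one_minus_cis_neg:
  assumes "- 2 * pi < \<alpha>" "\<alpha> < 0"
  shows "Im (Ln (1 - cis \<alpha>)) = (\<alpha> + pi) / 2"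
proof -
  have "cis (\<alpha> + 2 * pi) = cis \<alpha>"
    by (simp add: complex_eq_iff)
  thus ?thesis using Im_Ln_one_minus_cis[of "\<alpha> + 2 * pi"] assms by simp
qed

lemma cis_in_arc_iff:
  assumes "0 \<le> s" "u \<le> 2 * pi" "0 \<le> t" "t < 2 * pi"
  shows "cis t \<in> Defs.arc s u \<longleftrightarrow> t \<in> {s<..<u}"
proof
  assume "cis t \<in> Defs.arc s u"
  then obtain v where v: "s < v" "v < u" "cis v = cis t"
    by (auto simp: Defs.arc_def)
  have "Arg2pi (cis t) = t" "Arg2pi (cis v) = v"
    using assms v by (auto intro!: Arg2pi_unique[of 1] simp: cis_conv_exp)
  thus "t \<in> {s<..<u}" using v by auto
qed (auto simp: Defs.arc_def)

lemma mu0_arc: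
  assumes "0 \<le> s" "s \<le> u" "u \<le> 2 * pi"
  shows "mu0 (Defs.arc s u) = (u - s) / (2 * pi)"
proof -
  have "{t \<in> {0..<2*pi}. cis t \<in> Defs.arc s u} = {s<..<u}"
    using assms cis_in_arc_iff[of s u] by auto
  thus ?thesis using assms by (simp add: mu0_def)
qed

text \<open>The real part of the function below is the harmonic measure of the arc,
  read off from the angle under which the arc is seen.\<close>

lemma is_phi_arc:
  assumes su: "0 \<le> s" "s < u" "u \<le> 2 * pi"
  shows "is_phi (Defs.arc s u)
    (\<lambda>z. (Ln (1 - z * cis (- u)) - Ln (1 - z * cis (- s))) / (\<i> * pi) + of_real ((u - s) / (2 * pi)))"
    (is "is_phi _ ?\<phi>")
proof -
  have Re_pos: "Re (1 - z * cis \<alpha>) > 0" if "z \<in> ball 0 1" for z \<alpha>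
  proof -
    have "Re (z * cis \<alpha>) \<le> cmod (z * cis \<alpha>)" by (rule complex_Re_le_cmod)
    thus ?thesis using that by (simp add: norm_mult)
  qed
  have nn: "1 - z * cis \<alpha> \<notin> \<real>\<^sub>\<le>\<^sub>0" if "z \<in> ball 0 1" for z \<alpha>
    using Re_pos[OF that, of \<alpha>] by (auto simp: complex_nonpos_Reals_iff)
  have Re_phi: "Re (?\<phi> z) = (Im (Ln (1 - z * cis (- u))) - Im (Ln (1 - z * cis (- s)))) / pi + (u - s) / (2 * pi)" for z
    by (simp add: Re_divide Im_divide power2_eq_square field_simps)
  have "?\<phi> holomorphic_on ball 0 1"
    by (intro holomorphic_intros nn) auto
  moreover have "bounded (Re ` ?\<phi> ` ball 0 1)"
  proof -
    have "\<bar>Re (?\<phi> z)\<bar> \<le> 1 + (u - s) / (2 * pi)" if "z \<in> ball 0 1" for z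
    proof -
      have "\<bar>Im (Ln (1 - z * cis (- u))) - Im (Ln (1 - z * cis (- s)))\<bar> \<le> pi"
        using Re_Ln_pos_lt_imp[OF Re_pos[OF that, of "- u"]] Re_Ln_pos_lt_imp[OF Re_pos[OF that, of "- s"]]
        by linarith
      hence "\<bar>(Im (Ln (1 - z * cis (- u))) - Im (Ln (1 - z * cis (- s)))) / pi\<bar> \<le> 1"
        by (simp add: abs_divide)
      moreover have "0 \<le> (u - s) / (2 * pi)" using su by simp
      ultimately show ?thesis unfolding Re_phi by linarith
    qed
    thus ?thesis unfolding bounded_Re_image_iff by (intro exI[of _ "1 + (u - s) / (2 * pi)"]) auto
  qed
  moreover have "AE t in lborel. t \<in> {0..2*pi} \<longrightarrow>
        ((\<lambda>r. Re (?\<phi> (complex_of_real r * cis t))) \<longlongrightarrow> indicator (Defs.arc s u) (cis t)) (at_left 1)"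
  proof -
    have "AE t in lborel. t \<noteq> 0 \<and> t \<noteq> 2 * pi \<and> t \<noteq> s \<and> t \<noteq> u"
      by (intro AE_conjI AE_lborel_singleton)
    thus ?thesis
    proof eventually_elim
      case (elim t)
      show ?case
      proof
        assume "t \<in> {0..2*pi}"
        with elim have t: "0 < t" "t < 2 * pi" "t \<noteq> s" "t \<noteq> u" by auto
        have lim: "((\<lambda>r. Im (Ln (1 - complex_of_real r * cis t * cis (- v)))) \<longlongrightarrow> Im (Ln (1 - cis (t - v)))) (at_left 1)"
          if v: "0 \<le> v" "v \<le> 2 * pi" "t \<noteq> v" for v
        proof -
          \<comment> \<open>Both angles lie in [0, 2 pi] and \<open>t\<close> is strictly inside, so
            they cannot differ by a nonzero multiple of 2 pi. The radial limit thus stays off the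
            branch cut of \<open>Ln\<close>.\<close>
          have "cos (t - v) \<noteq> 1"
          proof
            assume "cos (t - v) = 1"
            then obtain n :: int where n: "t - v = of_int n * (2 * pi)"
              by (auto simp: cos_one_2pi_int mult_ac)
            have "\<bar>of_int n\<bar> * (2 * pi) = \<bar>t - v\<bar>"
              unfolding n by (simp add: abs_mult)
            also have "\<bar>t - v\<bar> < 1 * (2 * pi)" using t v by linarith
            finally have "\<bar>of_int n\<bar> * (2 * pi) < 1 * (2 * pi)" .
            hence "\<bar>of_int n :: real\<bar> < 1" by (simp only: mult_less_cancel_right) auto
            hence "n = 0" by linarith
            thus False using n v by simp
          qed
          hence "cos (t - v) < 1" using cos_le_one[of "t - v"] by linarith
          hence "1 - cis (t - v) \<notin> \<real>\<^sub>\<le>\<^sub>0" by (auto simp: complex_nonpos_Reals_iff)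
          hence "((\<lambda>r. Im (Ln (1 - complex_of_real r * cis (t - v)))) \<longlongrightarrow> Im (Ln (1 - complex_of_real 1 * cis (t - v)))) (at_left 1)"
            by (intro tendsto_intros) auto
          thus ?thesis by (simp add: mult.assoc cis_mult)
        qed
        have "((\<lambda>r. Re (?\<phi> (complex_of_real r * cis t))) \<longlongrightarrow>
           (Im (Ln (1 - cis (t - u))) - Im (Ln (1 - cis (t - s)))) / pi + (u - s) / (2 * pi)) (at_left 1)"
          unfolding Re_phi using su t by (intro tendsto_intros lim) auto
        also have "(Im (Ln (1 - cis (t - u))) - Im (Ln (1 - cis (t - s)))) / pi + (u - s) / (2 * pi)
            = indicator (Defs.arc s u) (cis t)"
        proof -
          \<comment> \<open>The imaginary part belonging to an endpoint \<open>v\<close> jumps by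
            \<open>pi\<close> when \<open>t\<close> crosses \<open>v\<close>. The difference is
            therefore \<open>(s - u) / 2\<close>, increased by \<open>pi\<close> exactly on the arc;
            the additive constant in the function cancels the first term.\<close>
          consider "t < s" | "s < t" "t < u" | "u < t" using t by linarith
          thus ?thesis
          proof cases
            case 1
            thus ?thesis using t su cis_in_arc_iff[of s u t]
              by (simp add: Im_Ln_one_minus_cis_neg[of "t - s"] Im_Ln_one_minus_cis_neg[of "t - u"] diff_divide_distrib add_divide_distrib)
          next
            case 2
            thus ?thesis using t su cis_in_arc_iff[of s u t]
              by (simp add: Im_Ln_one_minus_cis[of "t - s"] Im_Ln_one_minus_cis_neg[of "t - u"] diff_divide_distrib add_divide_distrib)
          next
            case 3
            thus ?thesis using t su cis_in_arc_iff[of s u t]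
              by (simp add: Im_Ln_one_minus_cis[of "t - s"] Im_Ln_one_minus_cis[of "t - u"] diff_divide_distrib add_divide_distrib)
          qed
        qed
        finally show "((\<lambda>r. Re (?\<phi> (complex_of_real r * cis t))) \<longlongrightarrow> indicator (Defs.arc s u) (cis t)) (at_left 1)" .
      qed
    qed
  qed
  ultimately show ?thesis unfolding is_phi_def by blast
qed

text \<open>The value is \<open>1 / pi\<close> times the integral of \<open>cis (- t)\<close> over
  the arc, as the integral formula for the derivative predicts for the indicator function.\<close>

lemma dphi_arc:
  assumes "0 \<le> s" "s < u" "u \<le> 2 * pi"
  shows "dphi (Defs.arc s u) = \<i> / pi * (cis (- u) - cis (- s))"
proof -
  define \<phi> where "\<phi> = (\<lambda>z. (Ln (1 - z * cis (- u)) - Ln (1 - z * cis (- s))) / (\<i> * pi)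
    + complex_of_real ((u - s) / (2 * pi)))"
  have phi: "is_phi (Defs.arc s u) \<phi>"
    unfolding \<phi>_def by (rule is_phi_arc[OF assms])
  hence "is_phi (Defs.arc s u) (SOME \<phi>. is_phi (Defs.arc s u) \<phi>)"
    by (rule someI[where P = "is_phi (Defs.arc s u)"])
  hence "dphi (Defs.arc s u) = deriv \<phi> 0"
    unfolding dphi_def using phi by (rule is_phi_deriv_unique)
  also have "(\<phi> has_field_derivative ((- cis (- u) + cis (- s)) / (\<i> * pi))) (at 0)"
    unfolding \<phi>_def by (auto intro!: derivative_eq_intros simp: complex_nonpos_Reals_iff)
  hence "deriv \<phi> 0 = (- cis (- u) + cis (- s)) / (\<i> * pi)"
    by (rule DERIV_imp_deriv)
  also have "\<dots> = \<i> / pi * (cis (- u) - cis (- s))"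
    by (simp add: field_simps)
  finally show ?thesis .
qed

section \<open>Quarter arcs and half arcs\<close>

lemma mu0_A4: "j < 4 \<Longrightarrow> mu0 (A4 j) = 1/4"
  unfolding A4_def by (subst mu0_arc) (auto simp: field_simps)

lemma mu0_A2: "j < 2 \<Longrightarrow> mu0 (A2 j) = 1/2"
  unfolding A2_def by (subst mu0_arc) (auto simp: field_simps)

lemma cis_minus_multiples:
  "cis (- pi) = - 1" "cis (- (pi * 3 / 2)) = \<i>" "cis (- (pi * 2)) = 1"
proof -
  have "pi * 3 / 2 = pi + pi / 2" by simp
  thus "cis (- (pi * 3 / 2)) = \<i>" by (simp only: complex_eq_iff cis.sel cos_minus sin_minus sin_add cos_add) simp
qed (simp_all add: complex_eq_iff)

text \<open>A rotation by a quarter turn multiplies the coefficient by \<open>- \<i>\<close>.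
  Everything is expressed by the last arc because the space there contributes its logarithm with
  coefficient 1 after normalization.\<close>

lemma dphi_A4:
  "dphi (A4 3) = (1 + \<i>) / pi"
  "dphi (A4 0) = - \<i> * dphi (A4 3)"
  "dphi (A4 1) = - dphi (A4 3)"
  "dphi (A4 2) = \<i> * dphi (A4 3)"
  unfolding A4_def by (simp_all add: dphi_arc cis_minus_multiples field_simps)

lemma dphi_A2: "dphi (A2 0) = - 2 * \<i> / pi" "dphi (A2 1) = 2 * \<i> / pi"
  unfolding A2_def by (simp_all add: dphi_arc cis_minus_multiples field_simps)

section \<open>Calderon products\<close>

text \<open>The quantifier runs over all measurable functions, infinite values included, so that the
  inclusion of \<open>kspace M N'\<close> in \<open>kspace M N\<close> is part of the
  estimate.\<close>

definition kdom :: "'a measure \<Rightarrow> 'a knorm \<Rightarrow> 'a knorm \<Rightarrow> bool" where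
  "kdom M N N' \<longleftrightarrow> (\<exists>K>0. \<forall>f\<in>borel_measurable M. N f \<le> ennreal K * N' f)"

text \<open>These properties are inherited by Calderon products. Replacing the triangle inequality by a
  bound for the maximum, up to the factor 2, makes the inheritance immediate.\<close>

definition klattice :: "'a measure \<Rightarrow> 'a knorm \<Rightarrow> bool" where
  "klattice M N \<longleftrightarrow>
     (\<forall>f\<in>borel_measurable M. \<forall>g\<in>borel_measurable M.
        (AE t in M. cmod (f t) \<le> cmod (g t)) \<longrightarrow> N f \<le> N g) \<and>
     (\<forall>f\<in>borel_measurable M. \<forall>c>0. N (\<lambda>t. complex_of_real c * f t) \<le> ennreal c * N f) \<and>
     (\<forall>f\<in>borel_measurable M. \<forall>g\<in>borel_measurable M. \<forall>r>0. N f \<le> ennreal r \<longrightarrow> N g \<le> ennreal r \<longrightarrow>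
        N (\<lambda>t. complex_of_real (max (cmod (f t)) (cmod (g t)))) \<le> ennreal (2 * r))"

lemma klattice_mono:
  assumes "klattice M N" "f \<in> borel_measurable M" "g \<in> borel_measurable M"
    "AE t in M. cmod (f t) \<le> cmod (g t)"
  shows "N f \<le> N g"
  using assms unfolding klattice_def by blast

lemma klattice_scale:
  assumes "klattice M N" "f \<in> borel_measurable M" "c > 0"
  shows "N (\<lambda>t. complex_of_real c * f t) \<le> ennreal c * N f"
  using assms unfolding klattice_def by blast

lemma klattice_max:
  assumes "klattice M N" "f \<in> borel_measurable M" "g \<in> borel_measurable M" "r > 0"
    "N f \<le> ennreal r" "N g \<le> ennreal r"
  shows "N (\<lambda>t. complex_of_real (max (cmod (f t)) (cmod (g t)))) \<le> ennreal (2 * r)"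
  using assms unfolding klattice_def by blast

section \<open>Koethe norms: lattice bounds and common majorants\<close>

lemma kothe_triangle:
  assumes "kothe M N" "f \<in> borel_measurable M" "g \<in> borel_measurable M"
  shows "N (\<lambda>t. f t + g t) \<le> N f + N g"
  using assms unfolding kothe_def by blast

lemma kothe_scale:
  assumes "kothe M N" "f \<in> borel_measurable M"
  shows "N (\<lambda>t. c * f t) = ennreal (cmod c) * N f"
  using assms unfolding kothe_def by blast

lemma kothe_mono:
  assumes "kothe M N" "f \<in> borel_measurable M" "g \<in> borel_measurable M"
    "AE t in M. cmod (f t) \<le> cmod (g t)"
  shows "N f \<le> N g"
  using assms unfolding kothe_def by blast

lemma kothe_complete:
  assumes "kothe M N" "\<forall>n. F n \<in> kspace M N"
    "\<forall>e>0. \<exists>m. \<forall>n\<ge>m. \<forall>k\<ge>m. N (\<lambda>t. F n t - F k t) < ennreal e"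
  shows "\<exists>f\<in>kspace M N. (\<lambda>n. N (\<lambda>t. F n t - f t)) \<longlonglongrightarrow> 0"
  using assms(1)[unfolded kothe_def, THEN conjunct2, THEN conjunct2, THEN conjunct2, THEN conjunct2,
      THEN conjunct1, rule_format, of F] assms(2,3) by blast

lemma kothe_imp_klattice:
  fixes M :: "'a measure"
  assumes k: "kothe M N"
  shows "klattice M N"
  unfolding klattice_def
proof (intro conjI ballI allI impI)
  fix f g :: "'a kfun" assume [measurable]: "f \<in> borel_measurable M" "g \<in> borel_measurable M"
  show "N f \<le> N g" if "AE t in M. cmod (f t) \<le> cmod (g t)"
    using that by (intro kothe_mono[OF k]) auto
  show "N (\<lambda>t. complex_of_real c * f t) \<le> ennreal c * N f" if "c > 0" for c
    using that by (subst kothe_scale[OF k]) auto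
  show "N (\<lambda>t. complex_of_real (max (cmod (f t)) (cmod (g t)))) \<le> ennreal (2 * r)"
    if r: "r > 0" "N f \<le> ennreal r" "N g \<le> ennreal r" for r
  proof -
    have "N (\<lambda>t. complex_of_real (max (cmod (f t)) (cmod (g t))))
        \<le> N (\<lambda>t. complex_of_real (cmod (f t)) + complex_of_real (cmod (g t)))"
      by (intro kothe_mono[OF k]) (auto simp: abs_of_nonneg le_max_iff_disj simp del: of_real_add simp flip: of_real_add)
    also have "\<dots> \<le> N (\<lambda>t. complex_of_real (cmod (f t))) + N (\<lambda>t. complex_of_real (cmod (g t)))"
      by (intro kothe_triangle[OF k]) auto
    also have "\<dots> \<le> N f + N g"
      by (intro add_mono kothe_mono[OF k]) auto
    also have "\<dots> \<le> ennreal r + ennreal r"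
      using r by (intro add_mono) auto
    also have "\<dots> = ennreal (2 * r)"
      using r by (simp flip: ennreal_plus)
    finally show ?thesis .
  qed
qed

text \<open>The infimum defining a Calderon product need not be attained. Working with an arbitrary
  real number strictly above it gives actual factors, and the strictness costs nothing in the final
  estimate.\<close>

lemma ennreal_le_multI:
  fixes X Y :: ennreal
  assumes k: "k > 0" and le: "\<And>l. 0 < l \<Longrightarrow> X < ennreal l \<Longrightarrow> Y \<le> ennreal (k * l)"
  shows "Y \<le> ennreal k * X"
proof (cases X)
  case (real x)
  show ?thesis
  proof (rule ennreal_le_epsilon)
    fix e :: real assume e: "e > 0"
    have "Y \<le> ennreal (k * (x + e / k))"
      using real e k by (intro le) (auto simp: ennreal_less_iff add_nonneg_pos)
    also have "k * (x + e / k) = k * x + e" using k by (simp add: field_simps)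
    also have "ennreal \<dots> = ennreal k * X + ennreal e"
      using real e k by (simp add: ennreal_mult)
    finally show "Y \<le> ennreal k * X + ennreal e" .
  qed
next
  case top
  thus ?thesis using k by (simp add: ennreal_mult_top)
qed

text \<open>The majorant is the limit of the absolutely convergent series of the
  \<open>cmod (a k t) / 2 ^ k\<close>, in the manner of Riesz and Fischer.\<close>

lemma kothe_dominating:
  fixes M :: "'a measure" and a :: "nat \<Rightarrow> 'a kfun"
  assumes k: "kothe M N" and meas[measurable]: "\<And>n. a n \<in> borel_measurable M"
    and a: "\<And>n. N (a n) \<le> 1"
  obtains w where "w \<in> kspace M N" "\<And>n. AE t in M. cmod (a n t) / 2 ^ n \<le> cmod (w t)"
proof -
  define S where "S n t = (\<Sum>k<n. cmod (a k t) / 2 ^ k)" for n t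
  define F where "F n t = complex_of_real (S n t)" for n t
  have [measurable]: "S n \<in> borel_measurable M" for n
    unfolding S_def[abs_def] by measurable
  have [measurable]: "F n \<in> borel_measurable M" for n
    unfolding F_def[abs_def] by measurable
  have S_mono: "0 \<le> S k t" "S k t \<le> S n t" if "k \<le> n" for k n t
    unfolding S_def using that by (auto intro!: sum_nonneg sum_mono2)
  have N0: "N (\<lambda>_. 0) = 0"
    using k unfolding kothe_def by simp
  \<comment> \<open>The bound is the exact geometric sum of \<open>1 / 2 ^ k\<close> for
    \<open>k\<close> from \<open>m\<close> to \<open>m + d - 1\<close>, which lets the induction on
    \<open>d\<close> close without loss.\<close>
  have step: "N (\<lambda>t. F (m + d) t - F m t) \<le> ennreal (2 / 2 ^ m - 2 / 2 ^ (m + d))" for m d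
  proof (induction d)
    case 0
    show ?case by (simp add: N0)
  next
    case (Suc d)
    let ?b = "\<lambda>t. (1 / 2 ^ (m + d)) * complex_of_real (cmod (a (m + d) t))"
    have "N ?b = ennreal (1 / 2 ^ (m + d)) * N (\<lambda>t. complex_of_real (cmod (a (m + d) t)))"
      by (subst kothe_scale[OF k]) (auto simp: norm_divide norm_power)
    also have "\<dots> \<le> ennreal (1 / 2 ^ (m + d)) * 1"
      by (intro mult_left_mono order_trans[OF kothe_mono[OF k] a]) auto
    finally have b: "N ?b \<le> ennreal (1 / 2 ^ (m + d))" by simp
    have "(\<lambda>t. F (m + Suc d) t - F m t) = (\<lambda>t. (F (m + d) t - F m t) + ?b t)"
      by (rule ext) (simp add: F_def S_def)
    hence "N (\<lambda>t. F (m + Suc d) t - F m t) \<le> N (\<lambda>t. F (m + d) t - F m t) + N ?b"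
      using kothe_triangle[OF k, of "\<lambda>t. F (m + d) t - F m t" ?b] by simp
    also have "\<dots> \<le> ennreal (2 / 2 ^ m - 2 / 2 ^ (m + d)) + ennreal (1 / 2 ^ (m + d))"
      by (intro add_mono Suc.IH b)
    also have "\<dots> = ennreal (2 / 2 ^ m - 2 / 2 ^ (m + d) + 1 / 2 ^ (m + d))"
      by (subst ennreal_plus) (auto simp: field_simps power_add)
    also have "2 / 2 ^ m - 2 / 2 ^ (m + d) + 1 / 2 ^ (m + d) = 2 / 2 ^ m - (2::real) / 2 ^ (m + Suc d)"
      by (simp add: field_simps)
    finally show ?case .
  qed
  have diff: "N (\<lambda>t. F n t - F k t) \<le> ennreal (2 / 2 ^ m)" if "k \<ge> m" "n \<ge> m" for m n k
  proof -
    have *: "N (\<lambda>t. F n t - F k t) \<le> ennreal (2 / 2 ^ m)" if "m \<le> k" "k \<le> n" for n k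
    proof -
      have "N (\<lambda>t. F n t - F k t) \<le> ennreal (2 / 2 ^ k - 2 / 2 ^ n)"
        using step[of k "n - k"] that by simp
      also have "\<dots> \<le> ennreal (2 / 2 ^ m)"
      proof (rule ennreal_leI)
        have "(2::real) / 2 ^ k \<le> 2 / 2 ^ m"
          using that by (intro divide_left_mono power_increasing) auto
        moreover have "(0::real) \<le> 2 / 2 ^ n" by simp
        ultimately show "(2::real) / 2 ^ k - 2 / 2 ^ n \<le> 2 / 2 ^ m" by linarith
      qed
      finally show ?thesis .
    qed
    show ?thesis
    proof (cases "k \<le> n")
      case True
      thus ?thesis using * that by blast
    next
      case False
      have "N (\<lambda>t. F n t - F k t) \<le> N (\<lambda>t. F k t - F n t)"
        by (intro kothe_mono[OF k]) (auto simp: norm_minus_commute)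
      also have "\<dots> \<le> ennreal (2 / 2 ^ m)" using * that False by simp
      finally show ?thesis .
    qed
  qed
  have "F n \<in> kspace M N" for n
  proof -
    have "N (F n) \<le> ennreal 2" using diff[of 0 0 n] by (simp add: F_def[abs_def] S_def[abs_def])
    also have "ennreal 2 < top" by simp
    finally show ?thesis by (simp add: kspace_def)
  qed
  moreover have "\<exists>m. \<forall>n\<ge>m. \<forall>k\<ge>m. N (\<lambda>t. F n t - F k t) < ennreal e" if e: "e > 0" for e
  proof -
    obtain m where "(1/2) ^ m < e / 2"
      using real_arch_pow_inv[of "e / 2" "1 / 2"] e by auto
    hence "2 / 2 ^ m < e" by (simp add: power_divide)
    hence "ennreal (2 / 2 ^ m) < ennreal e" using e by (simp add: ennreal_less_iff)
    thus ?thesis using diff[of m] by (meson le_less_trans)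
  qed
  ultimately obtain f where f: "f \<in> kspace M N" "(\<lambda>n. N (\<lambda>t. F n t - f t)) \<longlonglongrightarrow> 0"
    using kothe_complete[OF k, of F] by blast
  have [measurable]: "f \<in> borel_measurable M" using f by (simp add: kspace_def)
  have "AE t in M. cmod (a n t) / 2 ^ n \<le> cmod (f t)" for n
  proof -
    \<comment> \<open>Completeness provides convergence in norm only. The excess of one partial sum
      over the limit is a fixed function dominated by every later error, so its norm is 0 and it
      vanishes almost everywhere.\<close>
    define h where "h t = complex_of_real (max 0 (S (Suc n) t - cmod (f t)))" for t
    have [measurable]: "h \<in> borel_measurable M" unfolding h_def[abs_def] by measurable
    have "N h \<le> N (\<lambda>t. F m t - f t)" if "m \<ge> Suc n" for m
    proof (intro kothe_mono[OF k] AE_I2)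
      fix t
      have "S (Suc n) t - cmod (f t) \<le> cmod (F m t) - cmod (f t)"
        using S_mono[OF that] S_mono[OF order_refl, of m t] by (simp add: F_def)
      also have "\<dots> \<le> cmod (F m t - f t)" by (rule norm_triangle_ineq2)
      finally show "cmod (h t) \<le> cmod (F m t - f t)" by (simp add: h_def)
    qed auto
    hence "N h \<le> 0" using f(2) by (intro LIMSEQ_le_const) auto
    hence "AE t in M. h t = 0"
      using k unfolding kothe_def by auto
    thus ?thesis
    proof eventually_elim
      case (elim t)
      have "cmod (a n t) / 2 ^ n \<le> S (Suc n) t"
        using S_mono(1)[OF order_refl, of n t] by (simp add: S_def)
      also have "S (Suc n) t \<le> cmod (f t)" using elim by (simp add: h_def max_def split: if_splits)
      finally show ?case .
    qed
  qed
  thus ?thesis using f that by blast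
qed

section \<open>Calderon products with positive weights of sum 1\<close>

context
  fixes M :: "'a measure" and J :: "'j set" and \<theta> :: "'j \<Rightarrow> real" and Ns :: "'j \<Rightarrow> 'a knorm"
  assumes fin: "finite J" and lat: "\<And>j. j \<in> J \<Longrightarrow> klattice M (Ns j)"
    and pos: "\<And>j. j \<in> J \<Longrightarrow> \<theta> j > 0" and sum1: "(\<Sum>j\<in>J. \<theta> j) = 1"
begin

text \<open>Homogeneity of degree 1 of the weighted geometric mean: this is where the weights having
  sum 1 enters.\<close>

lemma prod_powr_scale:
  fixes c :: real
  assumes "c > 0"
  shows "(\<Prod>j\<in>J. (c * \<bar>a j\<bar>) powr \<theta> j) = c * (\<Prod>j\<in>J. \<bar>a j\<bar> powr \<theta> j)"
proof -
  have "(\<Prod>j\<in>J. (c * \<bar>a j\<bar>) powr \<theta> j) = (\<Prod>j\<in>J. c powr \<theta> j) * (\<Prod>j\<in>J. \<bar>a j\<bar> powr \<theta> j)"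
    using assms by (simp add: powr_mult prod.distrib)
  also have "(\<Prod>j\<in>J. c powr \<theta> j) = c powr (\<Sum>j\<in>J. \<theta> j)"
    using assms fin by (simp add: powr_sum)
  finally show ?thesis using assms sum1 by simp
qed

lemma calderon_le:
  assumes K: "K \<ge> 0" and r: "r > 0"
    and c: "\<And>j. j \<in> J \<Longrightarrow> c j \<in> borel_measurable M" "\<And>j. j \<in> J \<Longrightarrow> Ns j (c j) \<le> ennreal r"
    and f: "AE t in M. cmod (f t) \<le> K * (\<Prod>j\<in>J. cmod (c j t) powr \<theta> j)"
  shows "calderon M J \<theta> Ns f \<le> ennreal (K * r)"
  unfolding calderon_def
proof (rule INF_lower, safe intro!: exI)
  show "0 \<le> K * r" using K r by simp
  fix j assume j: "j \<in> J"
  show "(\<lambda>t. complex_of_real (1 / r) * c j t) \<in> borel_measurable M"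
    using c(1)[OF j] by measurable
  have "Ns j (\<lambda>t. complex_of_real (1 / r) * c j t) \<le> ennreal (1 / r) * Ns j (c j)"
    using r c j by (intro klattice_scale[OF lat]) auto
  also have "\<dots> \<le> ennreal (1 / r) * ennreal r"
    using c j by (intro mult_left_mono) auto
  also have "\<dots> = 1"
    using r by (simp flip: ennreal_mult)
  finally show "Ns j (\<lambda>t. complex_of_real (1 / r) * c j t) \<le> 1" .
next
  have eq: "K * r * (\<Prod>j\<in>J. cmod (complex_of_real (1 / r) * c j t) powr \<theta> j) =
      K * (\<Prod>j\<in>J. cmod (c j t) powr \<theta> j)" for t
    using prod_powr_scale[of "1 / r" "\<lambda>j. cmod (c j t)"] r
    by (simp add: norm_mult norm_divide)
  show "AE t in M. cmod (f t) \<le> K * r * (\<Prod>j\<in>J. cmod (complex_of_real (1 / r) * c j t) powr \<theta> j)"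
    unfolding eq by (rule f)
qed

lemma calderon_lessE:
  assumes "calderon M J \<theta> Ns f < ennreal l"
  obtains a where "\<And>j. j \<in> J \<Longrightarrow> a j \<in> borel_measurable M" "\<And>j. j \<in> J \<Longrightarrow> Ns j (a j) \<le> 1"
    "AE t in M. cmod (f t) \<le> l * (\<Prod>j\<in>J. cmod (a j t) powr \<theta> j)"
proof -
  obtain l' a where l': "0 \<le> l'" "ennreal l' < ennreal l"
    and a: "\<forall>j\<in>J. a j \<in> borel_measurable M \<and> Ns j (a j) \<le> 1"
    "AE t in M. cmod (f t) \<le> l' * (\<Prod>j\<in>J. cmod (a j t) powr \<theta> j)"
    using assms unfolding calderon_def INF_less_iff by auto
  have le: "l' \<le> l" using l' by (simp add: ennreal_less_iff)
  have "AE t in M. cmod (f t) \<le> l * (\<Prod>j\<in>J. cmod (a j t) powr \<theta> j)"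
    using a(2)
  proof eventually_elim
    case (elim t)
    also have "l' * (\<Prod>j\<in>J. cmod (a j t) powr \<theta> j) \<le> l * (\<Prod>j\<in>J. cmod (a j t) powr \<theta> j)"
      by (intro mult_right_mono le prod_nonneg) auto
    finally show ?case .
  qed
  thus ?thesis using a that by blast
qed

lemma calderon_klattice: "klattice M (calderon M J \<theta> Ns)"
  unfolding klattice_def
proof (intro conjI ballI allI impI)
  fix f g :: "'a kfun" assume [measurable]: "f \<in> borel_measurable M" "g \<in> borel_measurable M"
  show "calderon M J \<theta> Ns f \<le> calderon M J \<theta> Ns g" if le: "AE t in M. cmod (f t) \<le> cmod (g t)"
  proof -
    have "calderon M J \<theta> Ns f \<le> ennreal 1 * calderon M J \<theta> Ns g"
    proof (rule ennreal_le_multI)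
      fix l :: real assume l: "0 < l" "calderon M J \<theta> Ns g < ennreal l"
      obtain a where a: "\<And>j. j \<in> J \<Longrightarrow> a j \<in> borel_measurable M" "\<And>j. j \<in> J \<Longrightarrow> Ns j (a j) \<le> 1"
        "AE t in M. cmod (g t) \<le> l * (\<Prod>j\<in>J. cmod (a j t) powr \<theta> j)"
        using calderon_lessE[OF l(2)] by blast
      from le a(3) have "AE t in M. cmod (f t) \<le> l * (\<Prod>j\<in>J. cmod (a j t) powr \<theta> j)"
        by eventually_elim auto
      thus "calderon M J \<theta> Ns f \<le> ennreal (1 * l)"
        using calderon_le[of l 1 a f] l a by simp
    qed simp
    thus ?thesis by simp
  qed
  show "calderon M J \<theta> Ns (\<lambda>t. complex_of_real c * f t) \<le> ennreal c * calderon M J \<theta> Ns f" if c: "c > 0" for c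
  proof (rule ennreal_le_multI[OF c])
    fix l :: real assume l: "0 < l" "calderon M J \<theta> Ns f < ennreal l"
    obtain a where a: "\<And>j. j \<in> J \<Longrightarrow> a j \<in> borel_measurable M" "\<And>j. j \<in> J \<Longrightarrow> Ns j (a j) \<le> 1"
      "AE t in M. cmod (f t) \<le> l * (\<Prod>j\<in>J. cmod (a j t) powr \<theta> j)"
      using calderon_lessE[OF l(2)] by blast
    from a(3) have "AE t in M. cmod (complex_of_real c * f t) \<le> (c * l) * (\<Prod>j\<in>J. cmod (a j t) powr \<theta> j)"
      by eventually_elim (use c in \<open>simp add: norm_mult mult.assoc\<close>)
    thus "calderon M J \<theta> Ns (\<lambda>t. complex_of_real c * f t) \<le> ennreal (c * l)"
      using calderon_le[of "c * l" 1 a "\<lambda>t. complex_of_real c * f t"] l a c by simp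
  qed
  show "calderon M J \<theta> Ns (\<lambda>t. complex_of_real (max (cmod (f t)) (cmod (g t)))) \<le> ennreal (2 * r)"
    if r: "r > 0" "calderon M J \<theta> Ns f \<le> ennreal r" "calderon M J \<theta> Ns g \<le> ennreal r" for r
  proof -
    have "calderon M J \<theta> Ns (\<lambda>t. complex_of_real (max (cmod (f t)) (cmod (g t)))) \<le> ennreal 2 * ennreal r"
    proof (rule ennreal_le_multI)
      fix l :: real assume l: "0 < l" "ennreal r < ennreal l"
      obtain a where a: "\<And>j. j \<in> J \<Longrightarrow> a j \<in> borel_measurable M" "\<And>j. j \<in> J \<Longrightarrow> Ns j (a j) \<le> 1"
        "AE t in M. cmod (f t) \<le> l * (\<Prod>j\<in>J. cmod (a j t) powr \<theta> j)"
        using calderon_lessE[OF le_less_trans[OF r(2) l(2)]] by blast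
      obtain b where b: "\<And>j. j \<in> J \<Longrightarrow> b j \<in> borel_measurable M" "\<And>j. j \<in> J \<Longrightarrow> Ns j (b j) \<le> 1"
        "AE t in M. cmod (g t) \<le> l * (\<Prod>j\<in>J. cmod (b j t) powr \<theta> j)"
        using calderon_lessE[OF le_less_trans[OF r(3) l(2)]] by blast
      define c where "c j t = complex_of_real (max (cmod (a j t)) (cmod (b j t)))" for j t
      have c: "c j \<in> borel_measurable M" "Ns j (c j) \<le> ennreal 2" if j: "j \<in> J" for j
        using a(1,2)[OF j] b(1,2)[OF j] klattice_max[OF lat[OF j], of "a j" "b j" 1]
        by (auto simp: c_def[abs_def])
      \<comment> \<open>Maxima of the factors dominate both products at once. Each maximum has norm
        at most 2, and as the weights have sum 1 the product loses a single factor 2, whatever the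
        size of \<open>J\<close>.\<close>
      have le: "l * (\<Prod>j\<in>J. cmod (a j t) powr \<theta> j) \<le> l * (\<Prod>j\<in>J. cmod (c j t) powr \<theta> j)"
        "l * (\<Prod>j\<in>J. cmod (b j t) powr \<theta> j) \<le> l * (\<Prod>j\<in>J. cmod (c j t) powr \<theta> j)" for t
        using l pos by (auto intro!: mult_left_mono prod_mono powr_mono2 simp: c_def less_imp_le)
      from a(3) b(3) have "AE t in M. cmod (complex_of_real (max (cmod (f t)) (cmod (g t))))
          \<le> l * (\<Prod>j\<in>J. cmod (c j t) powr \<theta> j)"
      proof eventually_elim
        case (elim t)
        thus ?case using le[of t] by (simp add: abs_of_nonneg le_max_iff_disj)
      qed
      thus "calderon M J \<theta> Ns (\<lambda>t. complex_of_real (max (cmod (f t)) (cmod (g t)))) \<le> ennreal (2 * l)"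
        using calderon_le[of l 2 c "\<lambda>t. complex_of_real (max (cmod (f t)) (cmod (g t)))"] l c
        by (simp add: mult.commute)
    qed simp
    thus ?thesis using r by (simp add: ennreal_mult)
  qed
qed

text \<open>Enlarging both factorizations to their maximum costs the factor
  \<open>exp (\<Sum>\<theta>\<^sub>j (ln a\<^sub>j - ln b\<^sub>j)\<^sup>+)\<close>, which dominates the logarithmic difference.\<close>

lemma log_factorization_diff_le:
  fixes a b :: "'j \<Rightarrow> real"
  assumes a: "\<And>j. j \<in> J \<Longrightarrow> a j \<ge> 0" and b: "\<And>j. j \<in> J \<Longrightarrow> b j \<ge> 0"
    and xa: "x = (\<Prod>j\<in>J. a j powr \<theta> j)" and xb: "x = (\<Prod>j\<in>J. b j powr \<theta> j)"
    and i: "i \<in> J"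
  shows "x * \<bar>ln (a i) - ln (b i)\<bar> \<le> (1 / \<theta> i) * (\<Prod>j\<in>J. max (a j) (b j) powr \<theta> j)"
proof (cases "x = 0")
  case True
  thus ?thesis using pos[OF i] by (simp add: prod_nonneg)
next
  case False
  have a0: "a j > 0" if "j \<in> J" for j
    using False a[OF that] that fin unfolding xa by (auto simp: less_le)
  have b0: "b j > 0" if "j \<in> J" for j
    using False b[OF that] that fin unfolding xb by (auto simp: less_le)
  have prod_exp: "(\<Prod>j\<in>J. c j powr \<theta> j) = exp (\<Sum>j\<in>J. \<theta> j * ln (c j))" if "\<And>j. j \<in> J \<Longrightarrow> c j > 0" for c
    using fin that by (simp add: exp_sum powr_def less_imp_neq[symmetric])
  define m where "m j = max (a j) (b j)" for j
  \<comment> \<open>The logarithm of the ratio between the product of the maxima and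
    \<open>x\<close>. Relative to either factorization it is a sum of nonnegative terms, so each
    single term is at most \<open>D\<close>.\<close>
  define D where "D = (\<Sum>j\<in>J. \<theta> j * ln (m j)) - ln x"
  have m0: "m j > 0" "ln (a j) \<le> ln (m j)" "ln (b j) \<le> ln (m j)" if "j \<in> J" for j
    using a0[OF that] b0[OF that] by (auto simp: m_def)
  have lnx: "ln x = (\<Sum>j\<in>J. \<theta> j * ln (a j))" "ln x = (\<Sum>j\<in>J. \<theta> j * ln (b j))"
    using xa xb prod_exp[of a] prod_exp[of b] a0 b0 by simp_all
  have x0: "x > 0" unfolding xa by (intro prod_pos) (use a0 in force)
  have Da: "\<theta> i * (ln (m i) - ln (a i)) \<le> D"
  proof -
    have "D = (\<Sum>j\<in>J. \<theta> j * (ln (m j) - ln (a j)))"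
      unfolding D_def lnx(1) by (simp add: algebra_simps sum_subtractf)
    thus ?thesis
      using i fin m0 pos member_le_sum[of i J "\<lambda>j. \<theta> j * (ln (m j) - ln (a j))"] by (force simp: less_imp_le)
  qed
  have Db: "\<theta> i * (ln (m i) - ln (b i)) \<le> D"
  proof -
    have "D = (\<Sum>j\<in>J. \<theta> j * (ln (m j) - ln (b j)))"
      unfolding D_def lnx(2) by (simp add: algebra_simps sum_subtractf)
    thus ?thesis
      using i fin m0 pos member_le_sum[of i J "\<lambda>j. \<theta> j * (ln (m j) - ln (b j))"] by (force simp: less_imp_le)
  qed
  have "\<theta> i * \<bar>ln (a i) - ln (b i)\<bar> \<le> D"
    using Da Db a0[OF i] b0[OF i] by (auto simp: m_def max_def abs_if split: if_splits)
  \<comment> \<open>Multiplying by \<open>x\<close> turns \<open>exp D\<close> back into the product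
    of the maxima.\<close>
  also have "D \<le> exp D" using exp_ge_add_one_self[of D] by linarith
  finally have "x * (\<theta> i * \<bar>ln (a i) - ln (b i)\<bar>) \<le> x * exp D"
    using x0 by (intro mult_left_mono) auto
  also have "x * exp D = (\<Prod>j\<in>J. max (a j) (b j) powr \<theta> j)"
    using prod_exp[of m] m0 x0 by (simp add: D_def exp_diff m_def)
  finally show ?thesis using pos[OF i] by (simp add: field_simps)
qed

text \<open>Here \<open>bs\<close> is the convenient factorization, and the linear map is 0. The
  three parts of the constant come from the logarithms (\<open>K\<close>), from passing to maxima
  (2) and from almost optimality (\<open>C\<close>).\<close>

lemma trivial_if_factorizations_differ:
  assumes as: "aof M J \<theta> Ns as" and bs: "aof M J \<theta> Ns bs"
    and meas: "\<And>x. x \<in> kspace M (calderon M J \<theta> Ns) \<Longrightarrow> \<Omega> x \<in> borel_measurable M"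
    and \<Omega>: "\<And>x. x \<in> kspace M (calderon M J \<theta> Ns) \<Longrightarrow> AE t in M. \<Omega> x t =
       x t * (\<Sum>j\<in>J. \<kappa> j * complex_of_real (ln (cmod (as j x t)) - ln (cmod (bs j x t))))"
  shows "trivial M (calderon M J \<theta> Ns) \<Omega>"
proof -
  let ?N = "calderon M J \<theta> Ns"
  obtain C1 where C1: "\<And>x j. x \<in> kspace M ?N \<Longrightarrow> j \<in> J \<Longrightarrow> as j x \<in> borel_measurable M"
    "\<And>x j. x \<in> kspace M ?N \<Longrightarrow> j \<in> J \<Longrightarrow> Ns j (as j x) \<le> ennreal C1 * ?N x"
    "\<And>x. x \<in> kspace M ?N \<Longrightarrow> AE t in M. cmod (x t) = (\<Prod>j\<in>J. cmod (as j x t) powr \<theta> j)"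
    using as unfolding aof_def by blast
  obtain C2 where C2: "\<And>x j. x \<in> kspace M ?N \<Longrightarrow> j \<in> J \<Longrightarrow> bs j x \<in> borel_measurable M"
    "\<And>x j. x \<in> kspace M ?N \<Longrightarrow> j \<in> J \<Longrightarrow> Ns j (bs j x) \<le> ennreal C2 * ?N x"
    "\<And>x. x \<in> kspace M ?N \<Longrightarrow> AE t in M. cmod (x t) = (\<Prod>j\<in>J. cmod (bs j x t) powr \<theta> j)"
    using bs unfolding aof_def by blast
  \<comment> \<open>The constants in \<open>aof\<close> are arbitrary reals, possibly negative, so
    positivity is forced by the maximum with 1.\<close>
  define C where "C = max 1 (max C1 C2)"
  have C: "C > 0" "C1 \<le> C" "C2 \<le> C" by (auto simp: C_def)
  define K where "K = 1 + (\<Sum>j\<in>J. cmod (\<kappa> j) / \<theta> j)"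
  have K: "K > 0" unfolding K_def using pos by (intro add_pos_nonneg sum_nonneg) (auto simp: less_imp_le)
  have main: "?N (\<Omega> x) \<le> ennreal (K * (2 * C)) * ?N x" if x: "x \<in> kspace M ?N" for x
  proof (rule ennreal_le_multI)
    show "K * (2 * C) > 0" using K C by simp
    fix l :: real assume l: "0 < l" "?N x < ennreal l"
    define c where "c j t = complex_of_real (max (cmod (as j x t)) (cmod (bs j x t)))" for j t
    have c: "c j \<in> borel_measurable M" "Ns j (c j) \<le> ennreal (2 * (C * l))" if j: "j \<in> J" for j
    proof -
      have "ennreal C1 * ?N x \<le> ennreal C * ennreal l" "ennreal C2 * ?N x \<le> ennreal C * ennreal l"
        using C l by (auto intro!: mult_mono ennreal_leI)
      hence "Ns j (as j x) \<le> ennreal (C * l)" "Ns j (bs j x) \<le> ennreal (C * l)"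
        using C1(2)[OF x j] C2(2)[OF x j] C l by (auto simp: ennreal_mult intro: order_trans)
      thus "c j \<in> borel_measurable M" "Ns j (c j) \<le> ennreal (2 * (C * l))"
        using C1(1)[OF x j] C2(1)[OF x j] klattice_max[OF lat[OF j], of "as j x" "bs j x" "C * l"] C l
        by (auto simp: c_def[abs_def])
    qed
    have "AE t in M. cmod (\<Omega> x t) \<le> K * (\<Prod>j\<in>J. cmod (c j t) powr \<theta> j)"
      using C1(3)[OF x] C2(3)[OF x] \<Omega>[OF x]
    proof eventually_elim
      case (elim t)
      let ?P = "\<Prod>j\<in>J. cmod (c j t) powr \<theta> j"
      have P0: "?P \<ge> 0" by (intro prod_nonneg) auto
      have "cmod (\<Omega> x t) \<le> cmod (x t) * (\<Sum>j\<in>J. cmod (\<kappa> j) * \<bar>ln (cmod (as j x t)) - ln (cmod (bs j x t))\<bar>)"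
        unfolding elim(3) norm_mult
        by (intro mult_left_mono order_trans[OF norm_sum] sum_mono)
           (auto simp: norm_mult simp flip: of_real_diff)
      also have "\<dots> = (\<Sum>j\<in>J. cmod (\<kappa> j) * (cmod (x t) * \<bar>ln (cmod (as j x t)) - ln (cmod (bs j x t))\<bar>))"
        by (simp add: sum_distrib_left mult_ac)
      also have "\<dots> \<le> (\<Sum>j\<in>J. cmod (\<kappa> j) * (1 / \<theta> j * ?P))"
      proof (intro sum_mono mult_left_mono)
        fix i assume i: "i \<in> J"
        show "cmod (x t) * \<bar>ln (cmod (as i x t)) - ln (cmod (bs i x t))\<bar> \<le> 1 / \<theta> i * ?P"
          using log_factorization_diff_le[of "\<lambda>j. cmod (as j x t)" "\<lambda>j. cmod (bs j x t)" "cmod (x t)" i]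
            elim(1,2) i by (simp add: c_def abs_of_nonneg le_max_iff_disj)
      qed auto
      also have "\<dots> = (\<Sum>j\<in>J. cmod (\<kappa> j) / \<theta> j) * ?P"
        by (simp add: sum_distrib_right)
      also have "\<dots> \<le> K * ?P"
        using P0 by (intro mult_right_mono) (auto simp: K_def)
      finally show ?case .
    qed
    thus "?N (\<Omega> x) \<le> ennreal (K * (2 * C) * l)"
      using calderon_le[of K "2 * (C * l)" c "\<Omega> x"] K C l c by (simp add: mult.assoc)
  qed
  have fin': "\<Omega> x \<in> kspace M ?N" if x: "x \<in> kspace M ?N" for x
  proof -
    have "ennreal (K * (2 * C)) * ?N x < top"
      using x by (auto simp: kspace_def ennreal_mult_less_top)
    thus ?thesis using main[OF x] meas[OF x] by (auto simp: kspace_def)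
  qed
  show ?thesis
    unfolding trivial_def
    by (rule exI[of _ "\<lambda>_ _. 0"]) (use main fin' in auto)
qed

text \<open>A substitute for the closed graph theorem. Completeness is drawn from the factor spaces,
  while \<open>N\<close> enters through its lattice bounds and may therefore be a Calderon product
  itself.\<close>

lemma kspace_subset_imp_kdom:
  assumes kothe: "\<And>j. j \<in> J \<Longrightarrow> kothe M (Ns j)" and N: "klattice M N"
    and sub: "kspace M (calderon M J \<theta> Ns) \<subseteq> kspace M N"
  shows "kdom M N (calderon M J \<theta> Ns)"
proof -
  let ?P = "calderon M J \<theta> Ns"
  \<comment> \<open>By homogeneity it suffices to bound \<open>N\<close> on one ball. Otherwise
    there is, for each \<open>n\<close>, a function with norm below \<open>1 / 2 ^ n\<close> in the
    product and above \<open>2 ^ n\<close> for \<open>N\<close>.\<close>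
  have "\<exists>n::nat. \<forall>f\<in>borel_measurable M. ?P f < ennreal (1 / 2 ^ n) \<longrightarrow> N f \<le> ennreal (2 ^ n)"
  proof (rule ccontr)
    assume "\<not> ?thesis"
    hence "\<forall>n. \<exists>f. f \<in> borel_measurable M \<and> ?P f < ennreal (1 / 2 ^ n) \<and> ennreal (2 ^ n) < N f"
      by (simp add: not_le) blast
    then obtain f where f: "\<And>n::nat. f n \<in> borel_measurable M" "\<And>n. ?P (f n) < ennreal (1 / 2 ^ n)"
      "\<And>n. ennreal (2 ^ n) < N (f n)" by metis
    have "\<forall>n. \<exists>a. (\<forall>j\<in>J. a j \<in> borel_measurable M \<and> Ns j (a j) \<le> 1) \<and>
       (AE t in M. cmod (f n t) \<le> (1 / 2 ^ n) * (\<Prod>j\<in>J. cmod (a j t) powr \<theta> j))"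
    proof
      fix n show "\<exists>a. (\<forall>j\<in>J. a j \<in> borel_measurable M \<and> Ns j (a j) \<le> 1) \<and>
       (AE t in M. cmod (f n t) \<le> (1 / 2 ^ n) * (\<Prod>j\<in>J. cmod (a j t) powr \<theta> j))"
        by (rule calderon_lessE[OF f(2)[of n]]) blast
    qed
    from choice[OF this] obtain a where "\<forall>n. (\<forall>j\<in>J. a n j \<in> borel_measurable M \<and> Ns j (a n j) \<le> 1) \<and>
       (AE t in M. cmod (f n t) \<le> (1 / 2 ^ n) * (\<Prod>j\<in>J. cmod (a n j t) powr \<theta> j))" ..
    hence a: "\<And>n j. j \<in> J \<Longrightarrow> a n j \<in> borel_measurable M" "\<And>n j. j \<in> J \<Longrightarrow> Ns j (a n j) \<le> 1"
      "\<And>n. AE t in M. cmod (f n t) \<le> (1 / 2 ^ n) * (\<Prod>j\<in>J. cmod (a n j t) powr \<theta> j)" by blast+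
    have "\<forall>j\<in>J. \<exists>w. w \<in> kspace M (Ns j) \<and> (\<forall>n. AE t in M. cmod (a n j t) / 2 ^ n \<le> cmod (w t))"
    proof
      fix j assume j: "j \<in> J"
      show "\<exists>w. w \<in> kspace M (Ns j) \<and> (\<forall>n. AE t in M. cmod (a n j t) / 2 ^ n \<le> cmod (w t))"
        by (rule kothe_dominating[OF kothe[OF j], of "\<lambda>n. a n j"]) (use a j in blast)+
    qed
    from bchoice[OF this] obtain w where
      "\<forall>j\<in>J. w j \<in> kspace M (Ns j) \<and> (\<forall>n. AE t in M. cmod (a n j t) / 2 ^ n \<le> cmod (w j t))" ..
    hence w: "\<And>j. j \<in> J \<Longrightarrow> w j \<in> kspace M (Ns j)"
      "\<And>j n. j \<in> J \<Longrightarrow> AE t in M. cmod (a n j t) / 2 ^ n \<le> cmod (w j t)" by blast+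
    \<comment> \<open>The decay \<open>1 / 2 ^ n\<close> of \<open>f n\<close> can be moved into all
      factors simultaneously, since the weights have sum 1. After that \<open>w j\<close> dominates
      the \<open>j\<close>-th factor for every \<open>n\<close>, and \<open>z\<close> dominates
      every \<open>f n\<close>.\<close>
    define z where "z t = complex_of_real (\<Prod>j\<in>J. cmod (w j t) powr \<theta> j)" for t
    have w_meas: "w j \<in> borel_measurable M" if "j \<in> J" for j
      using w(1)[OF that] by (simp add: kspace_def)
    have z_meas: "z \<in> borel_measurable M"
    proof -
      have "(\<lambda>t. cmod (w j t) powr \<theta> j) \<in> borel_measurable M" if "j \<in> J" for j
        using w_meas[OF that] by measurable
      hence [measurable]: "(\<lambda>t. \<Prod>j\<in>J. cmod (w j t) powr \<theta> j) \<in> borel_measurable M"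
        by (rule borel_measurable_prod)
      show ?thesis unfolding z_def[abs_def] by measurable
    qed
    have cmod_z: "cmod (z t) = (\<Prod>j\<in>J. cmod (w j t) powr \<theta> j)" for t
      by (simp add: z_def prod_nonneg del: of_real_prod)
    define r where "r = 1 + (\<Sum>j\<in>J. enn2real (Ns j (w j)))"
    have "Ns j (w j) \<le> ennreal r" if j: "j \<in> J" for j
    proof -
      have "enn2real (Ns j (w j)) \<le> r"
        unfolding r_def using member_le_sum[of j J "\<lambda>j. enn2real (Ns j (w j))"] j fin by simp
      moreover have "Ns j (w j) = ennreal (enn2real (Ns j (w j)))"
        using w(1)[OF j] by (simp add: kspace_def)
      ultimately show ?thesis by (metis ennreal_leI)
    qed
    moreover have "r > 0" unfolding r_def by (intro add_pos_nonneg sum_nonneg) auto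
    ultimately have "?P z \<le> ennreal (1 * r)"
      using w_meas by (intro calderon_le[where c = w]) (auto simp: cmod_z)
    hence "z \<in> kspace M ?P" using z_meas by (auto simp: kspace_def intro: le_less_trans)
    hence "N z < top" using sub by (auto simp: kspace_def)
    then obtain s where s: "N z = ennreal s" "s \<ge> 0" by (cases "N z") auto
    have "N (f n) \<le> N z" for n
    proof (rule klattice_mono[OF N f(1) z_meas])
      have "AE t in M. \<forall>j\<in>J. cmod (a n j t) / 2 ^ n \<le> cmod (w j t)"
        using w(2) fin by (intro AE_finite_allI) auto
      with a(3)[of n] show "AE t in M. cmod (f n t) \<le> cmod (z t)"
      proof eventually_elim
        case (elim t)
        note elim(1)
        also have "(1 / 2 ^ n) * (\<Prod>j\<in>J. cmod (a n j t) powr \<theta> j) = (\<Prod>j\<in>J. ((1 / 2 ^ n) * cmod (a n j t)) powr \<theta> j)"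
          using prod_powr_scale[of "1 / 2 ^ n" "\<lambda>j. cmod (a n j t)"] by simp
        also have "\<dots> \<le> cmod (z t)"
          unfolding cmod_z using elim(2) pos by (intro prod_mono) (auto intro!: powr_mono2 simp: less_imp_le)
        finally show ?case .
      qed
    qed
    moreover obtain n where "s < 2 ^ n" using real_arch_pow[of 2 s] by auto
    hence "N z < ennreal (2 ^ n)" using s by (simp add: ennreal_less_iff)
    ultimately show False using f(3)[of n] by (meson leD le_less_trans less_imp_le)
  qed
  then obtain n :: nat where n: "\<And>f. f \<in> borel_measurable M \<Longrightarrow> ?P f < ennreal (1 / 2 ^ n) \<Longrightarrow> N f \<le> ennreal (2 ^ n)"
    by blast
  have "N f \<le> ennreal (4 ^ n) * ?P f" if f[measurable]: "f \<in> borel_measurable M" for f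
  proof (rule ennreal_le_multI)
    fix l :: real assume l: "0 < l" "?P f < ennreal l"
    \<comment> \<open>Scales \<open>f\<close> into the ball of radius \<open>1 / 2 ^ n\<close>.
      Undoing the scaling costs \<open>2 ^ n\<close> and the bound on the ball another
      \<open>2 ^ n\<close>, hence \<open>4 ^ n\<close>.\<close>
    define c where "c = 1 / (l * 2 ^ n)"
    have c: "c > 0" using l by (simp add: c_def)
    have "?P (\<lambda>t. complex_of_real c * f t) \<le> ennreal c * ?P f"
      by (rule klattice_scale[OF calderon_klattice f c])
    also have "\<dots> < ennreal c * ennreal l"
      using c l by (intro ennreal_mult_strict_left_mono) auto
    also have "\<dots> = ennreal (1 / 2 ^ n)"
      using l c by (simp add: c_def flip: ennreal_mult)
    finally have le: "N (\<lambda>t. complex_of_real c * f t) \<le> ennreal (2 ^ n)" by (intro n) auto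
    have "N f = N (\<lambda>t. complex_of_real (1 / c) * (complex_of_real c * f t))"
      using c by simp
    also have "\<dots> \<le> ennreal (1 / c) * N (\<lambda>t. complex_of_real c * f t)"
      using c by (intro klattice_scale[OF N]) auto
    also have "\<dots> \<le> ennreal (1 / c) * ennreal (2 ^ n)"
      by (intro mult_left_mono le) auto
    also have "\<dots> = ennreal (1 / c * 2 ^ n)" using c by (intro ennreal_mult[symmetric]) auto
    also have "1 / c * 2 ^ n = 4 ^ n * l"
      by (simp add: c_def flip: power_mult_distrib)
    finally show "N f \<le> ennreal (4 ^ n * l)" .
  qed simp
  thus ?thesis unfolding kdom_def by (intro exI[of _ "4 ^ n"]) auto
qed

end

section \<open>Passing between equivalent functionals\<close>

lemma kdom_trans:
  assumes "kdom M N1 N2" "kdom M N2 N3"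
  shows "kdom M N1 N3"
proof -
  obtain K L where K: "K > 0" "\<And>f. f \<in> borel_measurable M \<Longrightarrow> N1 f \<le> ennreal K * N2 f"
    and L: "L > 0" "\<And>f. f \<in> borel_measurable M \<Longrightarrow> N2 f \<le> ennreal L * N3 f"
    using assms unfolding kdom_def by blast
  have "N1 f \<le> ennreal (K * L) * N3 f" if f: "f \<in> borel_measurable M" for f
  proof -
    have "N1 f \<le> ennreal K * N2 f" using K f by blast
    also have "\<dots> \<le> ennreal K * (ennreal L * N3 f)" using L f by (intro mult_left_mono) auto
    also have "\<dots> = ennreal (K * L) * N3 f" using K L by (simp add: ennreal_mult mult.assoc)
    finally show ?thesis .
  qed
  thus ?thesis using K L unfolding kdom_def by (intro exI[of _ "K * L"]) auto
qed

lemma kdom_imp_kspace_subset: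
  assumes "kdom M N N'"
  shows "kspace M N' \<subseteq> kspace M N"
proof -
  obtain K where K: "\<And>f. f \<in> borel_measurable M \<Longrightarrow> N f \<le> ennreal K * N' f"
    using assms unfolding kdom_def by blast
  have "ennreal K * N' f < top" if "N' f < top" for f
    using that by (simp add: ennreal_mult_less_top)
  thus ?thesis using K unfolding kspace_def by (auto intro: le_less_trans)
qed

text \<open>The spaces coincide, so the same linear map serves. This carries the estimates from the
  product defined by a family to the norm in which the result is stated.\<close>

lemma trivial_transfer:
  assumes dom: "kdom M N N'" "kdom M N' N" and triv: "trivial M N \<Omega>"
  shows "trivial M N' \<Omega>"
proof -
  have eq: "kspace M N' = kspace M N"
    using dom kdom_imp_kspace_subset by blast
  obtain A B where A: "\<And>f. f \<in> borel_measurable M \<Longrightarrow> N f \<le> ennreal A * N' f" "A > 0"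
    and B: "\<And>f. f \<in> borel_measurable M \<Longrightarrow> N' f \<le> ennreal B * N f" "B > 0"
    using dom unfolding kdom_def by blast
  obtain L K where
    L: "\<forall>x \<in> kspace M N. \<forall>y \<in> kspace M N. \<forall>\<alpha> \<beta>.
        AE t in M. L (\<lambda>s. \<alpha> * x s + \<beta> * y s) t = \<alpha> * L x t + \<beta> * L y t"
    and K: "\<And>x. x \<in> kspace M N \<Longrightarrow> (\<lambda>t. \<Omega> x t - L x t) \<in> kspace M N"
        "\<And>x. x \<in> kspace M N \<Longrightarrow> N (\<lambda>t. \<Omega> x t - L x t) \<le> ennreal K * N x"
    using triv unfolding trivial_def by blast
  \<comment> \<open>The constant in \<open>trivial\<close> may be negative; its absolute value keeps
    the product of the constants multiplicative under \<open>ennreal\<close>.\<close>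
  have "N' (\<lambda>t. \<Omega> x t - L x t) \<le> ennreal (B * \<bar>K\<bar> * A) * N' x" if x: "x \<in> kspace M N" for x
  proof -
    have "N' (\<lambda>t. \<Omega> x t - L x t) \<le> ennreal B * N (\<lambda>t. \<Omega> x t - L x t)"
      using K(1)[OF x] by (intro B) (auto simp: kspace_def)
    also have "\<dots> \<le> ennreal B * (ennreal \<bar>K\<bar> * (ennreal A * N' x))"
    proof (rule mult_left_mono)
      have "N (\<lambda>t. \<Omega> x t - L x t) \<le> ennreal K * N x" by (rule K(2)[OF x])
      also have "\<dots> \<le> ennreal \<bar>K\<bar> * (ennreal A * N' x)"
        using x by (intro mult_mono ennreal_leI A) (auto simp: kspace_def)
      finally show "N (\<lambda>t. \<Omega> x t - L x t) \<le> ennreal \<bar>K\<bar> * (ennreal A * N' x)" .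
    qed simp
    also have "\<dots> = ennreal (B * \<bar>K\<bar> * A) * N' x"
      using A B by (simp add: ennreal_mult mult.assoc)
    finally show ?thesis .
  qed
  thus ?thesis unfolding trivial_def eq
    using L K(1) by (intro exI[of _ L] conjI exI[of _ "B * \<bar>K\<bar> * A"]) auto
qed

lemma calderon_cong:
  assumes "\<And>j. j \<in> J \<Longrightarrow> \<theta> j = \<theta>' j"
  shows "calderon M J \<theta> Ns = calderon M J \<theta>' Ns"
  unfolding calderon_def using assms by (simp cong: prod.cong)

lemma aof_cong:
  assumes "\<And>j. j \<in> J \<Longrightarrow> \<theta> j = \<theta>' j"
  shows "aof M J \<theta> Ns as \<longleftrightarrow> aof M J \<theta>' Ns as"
proof -
  have "calderon M J \<theta> Ns = calderon M J \<theta>' Ns" by (rule calderon_cong) (rule assms)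
  thus ?thesis unfolding aof_def using assms by (simp cong: prod.cong)
qed

lemma powr_quarter: "x \<ge> 0 \<Longrightarrow> x powr (1/4) = sqrt (sqrt x)" for x :: real
  by (simp add: powr_powr flip: powr_half_sqrt)

text \<open>A geometric mean is at most the maximum, so the bound for maxima takes the place of an
  inequality of Hoelder type.\<close>

lemma klattice_geometric_mean:
  assumes N: "klattice M N" and r: "r > 0" and l: "l > 0"
    and [measurable]: "f \<in> borel_measurable M" "p \<in> borel_measurable M" "q \<in> borel_measurable M"
    and pq: "N p \<le> ennreal r" "N q \<le> ennreal r"
    and f: "AE t in M. cmod (f t) \<le> l * (sqrt (cmod (p t)) * sqrt (cmod (q t)))"
  shows "N f \<le> ennreal (2 * r * l)"
proof -
  let ?m = "\<lambda>t. complex_of_real (max (cmod (p t)) (cmod (q t)))"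
  have "N f \<le> N (\<lambda>t. complex_of_real l * ?m t)"
  proof (rule klattice_mono[OF N])
    show "AE t in M. cmod (f t) \<le> cmod (complex_of_real l * ?m t)"
      using f
    proof eventually_elim
      case (elim t)
      note elim
      also have "sqrt (cmod (p t)) * sqrt (cmod (q t)) \<le>
          sqrt (max (cmod (p t)) (cmod (q t))) * sqrt (max (cmod (p t)) (cmod (q t)))"
        by (intro mult_mono) (auto simp: le_max_iff_disj)
      also have "\<dots> = max (cmod (p t)) (cmod (q t))"
        by (simp add: le_max_iff_disj abs_of_nonneg)
      finally show ?case using l by (simp add: norm_mult le_max_iff_disj abs_of_nonneg)
    qed
  qed measurable
  also have "\<dots> \<le> ennreal l * N ?m"
    using l by (intro klattice_scale[OF N]) auto
  also have "\<dots> \<le> ennreal l * ennreal (2 * r)"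
    using r pq by (intro mult_left_mono klattice_max[OF N]) auto
  also have "\<dots> = ennreal (2 * r * l)"
    using r l by (simp add: mult.commute flip: ennreal_mult)
  finally show ?thesis .
qed

section \<open>Products of two spaces\<close>

lemma pair_norm_altdef:
  "pair_norm M A B f = (INF l \<in> {l::real. l \<ge> 0 \<and> (\<exists>a\<in>borel_measurable M. \<exists>b\<in>borel_measurable M.
      A a \<le> 1 \<and> B b \<le> 1 \<and> (AE t in M. cmod (f t) \<le> l * (sqrt (cmod (a t)) * sqrt (cmod (b t)))))}. ennreal l)"
proof -
  have "(\<exists>as. (\<forall>j\<in>{0::nat, 1}. as j \<in> borel_measurable M \<and> (if j = 0 then A else B) (as j) \<le> 1) \<and>
          (AE t in M. cmod (f t) \<le> l * (\<Prod>j\<in>{0, 1}. cmod (as j t) powr (1 / 2)))) \<longleftrightarrow>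
      (\<exists>a\<in>borel_measurable M. \<exists>b\<in>borel_measurable M. A a \<le> 1 \<and> B b \<le> 1 \<and>
         (AE t in M. cmod (f t) \<le> l * (sqrt (cmod (a t)) * sqrt (cmod (b t)))))" (is "?L \<longleftrightarrow> ?R") for l
  proof
    assume ?L
    then obtain as where "\<forall>j\<in>{0::nat, 1}. as j \<in> borel_measurable M \<and> (if j = 0 then A else B) (as j) \<le> 1"
      "AE t in M. cmod (f t) \<le> l * (\<Prod>j\<in>{0, 1}. cmod (as j t) powr (1 / 2))" by blast
    thus ?R by (intro bexI[of _ "as 0"] bexI[of _ "as 1"]) (auto simp: powr_half_sqrt)
  next
    assume ?R
    then obtain a b where "a \<in> borel_measurable M" "b \<in> borel_measurable M" "A a \<le> 1" "B b \<le> 1"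
      "AE t in M. cmod (f t) \<le> l * (sqrt (cmod (a t)) * sqrt (cmod (b t)))" by blast
    thus ?L by (intro exI[of _ "\<lambda>j. if j = 0 then a else b"]) (auto simp: powr_half_sqrt)
  qed
  thus ?thesis unfolding pair_norm_def calderon_def by simp
qed

lemma pair_norm_commute: "pair_norm M A B = pair_norm M B A"
proof
  fix f
  have "(\<exists>a\<in>borel_measurable M. \<exists>b\<in>borel_measurable M. A a \<le> 1 \<and> B b \<le> 1 \<and>
         (AE t in M. cmod (f t) \<le> l * (sqrt (cmod (a t)) * sqrt (cmod (b t))))) \<longleftrightarrow>
      (\<exists>a\<in>borel_measurable M. \<exists>b\<in>borel_measurable M. B a \<le> 1 \<and> A b \<le> 1 \<and>
         (AE t in M. cmod (f t) \<le> l * (sqrt (cmod (a t)) * sqrt (cmod (b t)))))" for l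
    by (subst mult.commute[of "sqrt _"]) blast
  thus "pair_norm M A B f = pair_norm M B A f"
    unfolding pair_norm_altdef by simp
qed

lemma pair_norm_klattice:
  assumes "klattice M A" "klattice M B"
  shows "klattice M (pair_norm M A B)"
  unfolding pair_norm_def using assms by (intro calderon_klattice) auto

lemma pair_norm_le:
  assumes "klattice M A" "klattice M B" "K \<ge> 0" "r > 0"
    "a \<in> borel_measurable M" "b \<in> borel_measurable M" "A a \<le> ennreal r" "B b \<le> ennreal r"
    "AE t in M. cmod (f t) \<le> K * (sqrt (cmod (a t)) * sqrt (cmod (b t)))"
  shows "pair_norm M A B f \<le> ennreal (K * r)"
  unfolding pair_norm_def using assms
  by (intro calderon_le[where c = "\<lambda>j. if j = 0 then a else b"]) (auto simp: powr_half_sqrt)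

lemma pair_norm_lessE:
  assumes "pair_norm M A B f < ennreal l"
  obtains a b where "a \<in> borel_measurable M" "b \<in> borel_measurable M" "A a \<le> ennreal 1" "B b \<le> ennreal 1"
    "AE t in M. cmod (f t) \<le> l * (sqrt (cmod (a t)) * sqrt (cmod (b t)))"
proof -
  obtain l' a b where l': "0 \<le> l'" "ennreal l' < ennreal l"
    and ab: "a \<in> borel_measurable M" "b \<in> borel_measurable M" "A a \<le> 1" "B b \<le> 1"
    "AE t in M. cmod (f t) \<le> l' * (sqrt (cmod (a t)) * sqrt (cmod (b t)))"
    using assms unfolding pair_norm_altdef INF_less_iff by auto
  have le: "l' \<le> l" using l' by (simp add: ennreal_less_iff)
  have "AE t in M. cmod (f t) \<le> l * (sqrt (cmod (a t)) * sqrt (cmod (b t)))"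
    using ab(5)
  proof eventually_elim
    case (elim t)
    also have "l' * (sqrt (cmod (a t)) * sqrt (cmod (b t))) \<le> l * (sqrt (cmod (a t)) * sqrt (cmod (b t)))"
      by (intro mult_right_mono le) auto
    finally show ?case .
  qed
  thus ?thesis using ab that by simp
qed

lemma pair_aof_iff:
  "pair_aof M A B a b \<longleftrightarrow> (\<exists>C::real. \<forall>x \<in> kspace M (pair_norm M A B).
      a x \<in> borel_measurable M \<and> b x \<in> borel_measurable M \<and>
      A (a x) \<le> ennreal C * pair_norm M A B x \<and> B (b x) \<le> ennreal C * pair_norm M A B x \<and>
      (AE t in M. cmod (x t) = sqrt (cmod (a x t)) * sqrt (cmod (b x t))))"
  unfolding pair_aof_def aof_def pair_norm_def by (simp add: powr_half_sqrt conj_ac)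

lemma pair_aof_commute:
  assumes "pair_aof M A B a b"
  shows "pair_aof M B A b a"
proof -
  obtain C where "\<And>x. x \<in> kspace M (pair_norm M A B) \<Longrightarrow>
      a x \<in> borel_measurable M \<and> b x \<in> borel_measurable M \<and>
      A (a x) \<le> ennreal C * pair_norm M A B x \<and> B (b x) \<le> ennreal C * pair_norm M A B x \<and>
      (AE t in M. cmod (x t) = sqrt (cmod (a x t)) * sqrt (cmod (b x t)))"
    using assms unfolding pair_aof_iff by blast
  thus ?thesis
    unfolding pair_aof_iff pair_norm_commute[of M B A]
    by (intro exI[of _ C]) (simp add: mult.commute)
qed

text \<open>By the conventions for division by zero and \<open>ln 0\<close> this holds at every
  point, so it can be used as a rewrite rule under the binders of the final statement.\<close>

lemma pair_diff_commute: "pair_diff b a x t = - pair_diff a b x t"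
proof -
  have "ln (u / v) = - ln (v / u)" for u v :: real
    using ln_inverse[of "v / u"] by (simp add: inverse_eq_divide)
  from this[of "cmod (a x t)" "cmod (b x t)"] show ?thesis
    unfolding pair_diff_def by simp
qed

lemma pair_aof_measurable:
  assumes "pair_aof M A B a b" "x \<in> kspace M (pair_norm M A B)"
  shows "pair_diff a b x \<in> borel_measurable M"
proof -
  have [measurable]: "a x \<in> borel_measurable M" "b x \<in> borel_measurable M" "x \<in> borel_measurable M"
    using assms unfolding pair_aof_iff by (auto simp: kspace_def)
  show ?thesis unfolding pair_diff_def[abs_def] by measurable
qed

lemma fam_diff_measurable:
  assumes "aof M J \<theta> Ns as" "x \<in> kspace M (calderon M J \<theta> Ns)"
  shows "fam_diff J arcs as x \<in> borel_measurable M"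
proof -
  have "x \<in> borel_measurable M" using assms by (auto simp: kspace_def)
  moreover have "(\<lambda>t. dphi (arcs j) * complex_of_real (ln (cmod (as j x t)))) \<in> borel_measurable M" if "j \<in> J" for j
  proof -
    have [measurable]: "as j x \<in> borel_measurable M"
      using assms that unfolding aof_def by blast
    show ?thesis by measurable
  qed
  ultimately show ?thesis
    unfolding fam_diff_def[abs_def] by (rule borel_measurable_times[OF _ borel_measurable_sum])
qed

section \<open>Products of four spaces and iterated products\<close>

text \<open>The arguments follow the cyclic order of the quarter arcs: the first and third are
  opposite, as are the second and fourth.\<close>

definition quad_norm :: "'a measure \<Rightarrow> 'a knorm \<Rightarrow> 'a knorm \<Rightarrow> 'a knorm \<Rightarrow> 'a knorm \<Rightarrow> 'a knorm" where
  "quad_norm M A B C D = calderon M {0..<4} (\<lambda>_. 1/4) (sel4 A B C D)"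

lemma atLeastLessThan_0_4: "{0..<4} = {0, 1, 2, 3::nat}"
  by auto

lemma sel4_simps [simp]:
  "sel4 a b c d 0 = a" "sel4 a b c d 1 = b" "sel4 a b c d (Suc 0) = b" "sel4 a b c d 2 = c" "sel4 a b c d 3 = d"
  by (simp_all add: sel4_def)

lemma quad_norm_le:
  assumes "klattice M A" "klattice M B" "klattice M C" "klattice M D" "K \<ge> 0" "r > 0"
    "a \<in> borel_measurable M" "b \<in> borel_measurable M" "c \<in> borel_measurable M" "d \<in> borel_measurable M"
    "A a \<le> ennreal r" "B b \<le> ennreal r" "C c \<le> ennreal r" "D d \<le> ennreal r"
    "AE t in M. cmod (f t) \<le> K * (sqrt (sqrt (cmod (a t))) * sqrt (sqrt (cmod (b t))) *
        sqrt (sqrt (cmod (c t))) * sqrt (sqrt (cmod (d t))))"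
  shows "quad_norm M A B C D f \<le> ennreal (K * r)"
  unfolding quad_norm_def using assms
  by (intro calderon_le[where c = "sel4 a b c d"]) (auto simp: powr_quarter atLeastLessThan_0_4 mult.assoc)

lemma quad_norm_lessE:
  assumes "quad_norm M A B C D f < ennreal l"
    and "klattice M A" "klattice M B" "klattice M C" "klattice M D"
  obtains a b c d where
    "a \<in> borel_measurable M" "b \<in> borel_measurable M" "c \<in> borel_measurable M" "d \<in> borel_measurable M"
    "A a \<le> ennreal 1" "B b \<le> ennreal 1" "C c \<le> ennreal 1" "D d \<le> ennreal 1"
    "AE t in M. cmod (f t) \<le> l * (sqrt (sqrt (cmod (a t))) * sqrt (sqrt (cmod (b t))) *
        sqrt (sqrt (cmod (c t))) * sqrt (sqrt (cmod (d t))))"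
proof -
  obtain as where as: "\<And>j. j \<in> {0..<4} \<Longrightarrow> as j \<in> borel_measurable M"
    "\<And>j. j \<in> {0..<4} \<Longrightarrow> sel4 A B C D j (as j) \<le> 1"
    "AE t in M. cmod (f t) \<le> l * (\<Prod>j\<in>{0..<4}. cmod (as j t) powr (1/4))"
    by (rule calderon_lessE[OF _ _ _ _ assms(1)[unfolded quad_norm_def]])
       (use assms in \<open>auto simp: atLeastLessThan_0_4\<close>)
  show ?thesis
    by (rule that[of "as 0" "as 1" "as 2" "as 3"])
       (use as(1)[of 0] as(1)[of 1] as(1)[of 2] as(1)[of 3] as(2)[of 0] as(2)[of 1] as(2)[of 2] as(2)[of 3] as(3)
        in \<open>simp_all add: powr_quarter atLeastLessThan_0_4 mult.assoc\<close>)
qed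

text \<open>The product of four spaces is the geometric mean of the two pair products, and the
  geometric mean of two equivalent functionals is equivalent to each of them.\<close>

lemma kdom_quad_norm:
  assumes lat: "klattice M U0" "klattice M U1" "klattice M V0" "klattice M V1"
    and dom: "kdom M (pair_norm M U0 U1) (pair_norm M V0 V1)" "kdom M (pair_norm M V0 V1) (pair_norm M U0 U1)"
  shows "kdom M (quad_norm M U0 V0 U1 V1) (pair_norm M U0 U1)"
    and "kdom M (pair_norm M U0 U1) (quad_norm M U0 V0 U1 V1)"
proof -
  obtain K where K: "K > 0" "\<And>f. f \<in> borel_measurable M \<Longrightarrow> pair_norm M V0 V1 f \<le> ennreal K * pair_norm M U0 U1 f"
    using dom(2) unfolding kdom_def by blast
  have "quad_norm M U0 V0 U1 V1 f \<le> ennreal (1 + K) * pair_norm M U0 U1 f" if f: "f \<in> borel_measurable M" for f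
  proof (rule ennreal_le_multI)
    fix l :: real assume l: "0 < l" "pair_norm M U0 U1 f < ennreal l"
    \<comment> \<open>A common number strictly above both pair norms of \<open>f\<close>, as
      extracting factors requires; the second norm is at most \<open>K * l\<close>.\<close>
    define m where "m = (1 + K) * l"
    have m: "m > 0" using K l by (simp add: m_def)
    have "pair_norm M U0 U1 f < ennreal m"
      using l K by (intro less_le_trans[OF l(2)] ennreal_leI) (simp add: m_def algebra_simps)
    then obtain a c where ac: "a \<in> borel_measurable M" "c \<in> borel_measurable M" "U0 a \<le> ennreal 1" "U1 c \<le> ennreal 1"
      "AE t in M. cmod (f t) \<le> m * (sqrt (cmod (a t)) * sqrt (cmod (c t)))"
      by (rule pair_norm_lessE)
    have "pair_norm M V0 V1 f \<le> ennreal K * ennreal l"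
      using l by (intro order_trans[OF K(2)[OF f]] mult_left_mono) auto
    also have "\<dots> < ennreal m"
      using K l by (simp add: m_def ennreal_less_iff algebra_simps flip: ennreal_mult)
    finally obtain b d where bd: "b \<in> borel_measurable M" "d \<in> borel_measurable M" "V0 b \<le> ennreal 1" "V1 d \<le> ennreal 1"
      "AE t in M. cmod (f t) \<le> m * (sqrt (cmod (b t)) * sqrt (cmod (d t)))"
      by (rule pair_norm_lessE)
    have "AE t in M. cmod (f t) \<le> m * (sqrt (sqrt (cmod (a t))) * sqrt (sqrt (cmod (b t))) *
        sqrt (sqrt (cmod (c t))) * sqrt (sqrt (cmod (d t))))"
      using ac(5) bd(5)
    proof eventually_elim
      case (elim t)
      \<comment> \<open>One square root of the modulus is factored through the pair
        \<open>U\<close>, the other through the pair \<open>V\<close>.\<close>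
      have "cmod (f t) = sqrt (cmod (f t)) * sqrt (cmod (f t))" by simp
      also have "\<dots> \<le> sqrt (m * (sqrt (cmod (a t)) * sqrt (cmod (c t)))) * sqrt (m * (sqrt (cmod (b t)) * sqrt (cmod (d t))))"
        using elim m by (intro mult_mono) auto
      also have "\<dots> = (sqrt m * sqrt m) * (sqrt (sqrt (cmod (a t))) * sqrt (sqrt (cmod (b t))) *
        sqrt (sqrt (cmod (c t))) * sqrt (sqrt (cmod (d t))))"
        by (simp only: real_sqrt_mult mult_ac)
      finally show ?case using m by simp
    qed
    thus "quad_norm M U0 V0 U1 V1 f \<le> ennreal ((1 + K) * l)"
      using quad_norm_le[of M U0 V0 U1 V1 m 1 a b c d f] lat ac bd m by (simp add: m_def)
  qed (use K in simp)
  thus "kdom M (quad_norm M U0 V0 U1 V1) (pair_norm M U0 U1)"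
    using K unfolding kdom_def by (intro exI[of _ "1 + K"]) auto
next
  obtain K where K: "K > 0" "\<And>f. f \<in> borel_measurable M \<Longrightarrow> pair_norm M U0 U1 f \<le> ennreal K * pair_norm M V0 V1 f"
    using dom(1) unfolding kdom_def by blast
  have "pair_norm M U0 U1 f \<le> ennreal (2 * (1 + K)) * quad_norm M U0 V0 U1 V1 f" if f: "f \<in> borel_measurable M" for f
  proof (rule ennreal_le_multI)
    fix l :: real assume l: "0 < l" "quad_norm M U0 V0 U1 V1 f < ennreal l"
    obtain a b c d where [measurable]:
      "a \<in> borel_measurable M" "b \<in> borel_measurable M" "c \<in> borel_measurable M" "d \<in> borel_measurable M"
      and le: "U0 a \<le> ennreal 1" "V0 b \<le> ennreal 1" "U1 c \<le> ennreal 1" "V1 d \<le> ennreal 1"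
      and fle: "AE t in M. cmod (f t) \<le> l * (sqrt (sqrt (cmod (a t))) * sqrt (sqrt (cmod (b t))) *
        sqrt (sqrt (cmod (c t))) * sqrt (sqrt (cmod (d t))))"
      by (rule quad_norm_lessE[OF l(2)]) (use lat in auto)
    \<comment> \<open>The four factors are regrouped by opposite positions into one element of each
      pair product.\<close>
    define p where "p t = complex_of_real (sqrt (cmod (a t)) * sqrt (cmod (c t)))" for t
    define q where "q t = complex_of_real (sqrt (cmod (b t)) * sqrt (cmod (d t)))" for t
    have [measurable]: "p \<in> borel_measurable M" "q \<in> borel_measurable M"
      unfolding p_def[abs_def] q_def[abs_def] by measurable
    have pq: "cmod (p t) = sqrt (cmod (a t)) * sqrt (cmod (c t))" "cmod (q t) = sqrt (cmod (b t)) * sqrt (cmod (d t))" for t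
      by (simp_all add: p_def q_def norm_mult)
    have "pair_norm M U0 U1 p \<le> ennreal (1 * 1)"
      using le lat by (intro pair_norm_le[where a = a and b = c]) (auto simp: pq)
    also have "\<dots> \<le> ennreal (1 + K)" using K by (intro ennreal_leI) auto
    finally have p: "pair_norm M U0 U1 p \<le> ennreal (1 + K)" .
    have "pair_norm M U0 U1 q \<le> ennreal K * pair_norm M V0 V1 q" by (intro K) auto
    also have "\<dots> \<le> ennreal K * ennreal (1 * 1)"
      using le lat by (intro mult_left_mono pair_norm_le[where a = b and b = d]) (auto simp: pq)
    also have "\<dots> \<le> ennreal (1 + K)" using K by (simp add: ennreal_leI)
    finally have q: "pair_norm M U0 U1 q \<le> ennreal (1 + K)" .
    have "AE t in M. cmod (f t) \<le> l * (sqrt (cmod (p t)) * sqrt (cmod (q t)))"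
      using fle unfolding pq by (simp add: real_sqrt_mult mult_ac)
    from klattice_geometric_mean[OF pair_norm_klattice[OF lat(1,2)] _ l(1) f _ _ p q this]
    show "pair_norm M U0 U1 f \<le> ennreal (2 * (1 + K) * l)" using K by simp
  qed (use K in simp)
  thus "kdom M (pair_norm M U0 U1) (quad_norm M U0 V0 U1 V1)"
    using K unfolding kdom_def by (intro exI[of _ "2 * (1 + K)"]) auto
qed

text \<open>A reiteration statement: the four factors are now grouped by neighbours instead of
  opposite positions, and nested square roots give the weights 1/4.\<close>

lemma kdom_pair_norm_pair_norm:
  assumes lat: "klattice M U0" "klattice M U1" "klattice M V0" "klattice M V1"
  shows "kdom M (quad_norm M U0 V0 U1 V1) (pair_norm M (pair_norm M U0 V0) (pair_norm M U1 V1))"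
    and "kdom M (pair_norm M (pair_norm M U0 V0) (pair_norm M U1 V1)) (quad_norm M U0 V0 U1 V1)"
proof -
  let ?P = "pair_norm M (pair_norm M U0 V0) (pair_norm M U1 V1)"
  have "quad_norm M U0 V0 U1 V1 f \<le> ennreal 2 * ?P f" for f
  proof (rule ennreal_le_multI)
    fix l :: real assume l: "0 < l" "?P f < ennreal l"
    obtain p q where "p \<in> borel_measurable M" "q \<in> borel_measurable M" and pq: "pair_norm M U0 V0 p \<le> ennreal 1" "pair_norm M U1 V1 q \<le> ennreal 1"
      "AE t in M. cmod (f t) \<le> l * (sqrt (cmod (p t)) * sqrt (cmod (q t)))"
      by (rule pair_norm_lessE[OF l(2)])
    \<comment> \<open>The norms of \<open>p\<close> and \<open>q\<close> are at most 1, perhaps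
      equal to 1, and extracting factors needs a strict bound. The two values 2 enter under square
      roots, so one factor 2 results.\<close>
    have "ennreal 1 < ennreal 2" by (simp add: ennreal_less_iff)
    hence lt: "pair_norm M U0 V0 p < ennreal 2" "pair_norm M U1 V1 q < ennreal 2"
      using pq le_less_trans by blast+
    obtain a b where ab: "a \<in> borel_measurable M" "b \<in> borel_measurable M" "U0 a \<le> ennreal 1" "V0 b \<le> ennreal 1"
      "AE t in M. cmod (p t) \<le> 2 * (sqrt (cmod (a t)) * sqrt (cmod (b t)))"
      by (rule pair_norm_lessE[OF lt(1)])
    obtain c d where cd: "c \<in> borel_measurable M" "d \<in> borel_measurable M" "U1 c \<le> ennreal 1" "V1 d \<le> ennreal 1"
      "AE t in M. cmod (q t) \<le> 2 * (sqrt (cmod (c t)) * sqrt (cmod (d t)))"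
      by (rule pair_norm_lessE[OF lt(2)])
    have "AE t in M. cmod (f t) \<le> (2 * l) * (sqrt (sqrt (cmod (a t))) * sqrt (sqrt (cmod (b t))) *
        sqrt (sqrt (cmod (c t))) * sqrt (sqrt (cmod (d t))))"
      using pq(3) ab(5) cd(5)
    proof eventually_elim
      case (elim t)
      note elim(1)
      also have "l * (sqrt (cmod (p t)) * sqrt (cmod (q t))) \<le>
          l * (sqrt (2 * (sqrt (cmod (a t)) * sqrt (cmod (b t)))) * sqrt (2 * (sqrt (cmod (c t)) * sqrt (cmod (d t)))))"
        using elim l by (intro mult_left_mono mult_mono) auto
      also have "\<dots> = (sqrt 2 * sqrt 2) * l * (sqrt (sqrt (cmod (a t))) * sqrt (sqrt (cmod (b t))) *
        sqrt (sqrt (cmod (c t))) * sqrt (sqrt (cmod (d t))))"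
        by (simp only: real_sqrt_mult mult_ac)
      finally show ?case by simp
    qed
    thus "quad_norm M U0 V0 U1 V1 f \<le> ennreal (2 * l)"
      using quad_norm_le[of M U0 V0 U1 V1 "2 * l" 1 a b c d f] lat ab cd l by simp
  qed simp
  thus "kdom M (quad_norm M U0 V0 U1 V1) ?P"
    unfolding kdom_def by (intro exI[of _ 2]) auto
  have "?P f \<le> ennreal 1 * quad_norm M U0 V0 U1 V1 f" for f
  proof (rule ennreal_le_multI)
    fix l :: real assume l: "0 < l" "quad_norm M U0 V0 U1 V1 f < ennreal l"
    obtain a b c d where [measurable]:
      "a \<in> borel_measurable M" "b \<in> borel_measurable M" "c \<in> borel_measurable M" "d \<in> borel_measurable M"
      and le: "U0 a \<le> ennreal 1" "V0 b \<le> ennreal 1" "U1 c \<le> ennreal 1" "V1 d \<le> ennreal 1"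
      and fle: "AE t in M. cmod (f t) \<le> l * (sqrt (sqrt (cmod (a t))) * sqrt (sqrt (cmod (b t))) *
        sqrt (sqrt (cmod (c t))) * sqrt (sqrt (cmod (d t))))"
      by (rule quad_norm_lessE[OF l(2)]) (use lat in auto)
    define p where "p t = complex_of_real (sqrt (cmod (a t)) * sqrt (cmod (b t)))" for t
    define q where "q t = complex_of_real (sqrt (cmod (c t)) * sqrt (cmod (d t)))" for t
    have [measurable]: "p \<in> borel_measurable M" "q \<in> borel_measurable M"
      unfolding p_def[abs_def] q_def[abs_def] by measurable
    have pq: "cmod (p t) = sqrt (cmod (a t)) * sqrt (cmod (b t))" "cmod (q t) = sqrt (cmod (c t)) * sqrt (cmod (d t))" for t
      by (simp_all add: p_def q_def norm_mult)
    have "pair_norm M U0 V0 p \<le> ennreal (1 * 1)"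
      using le lat by (intro pair_norm_le[where a = a and b = b]) (auto simp: pq)
    moreover have "pair_norm M U1 V1 q \<le> ennreal (1 * 1)"
      using le lat by (intro pair_norm_le[where a = c and b = d]) (auto simp: pq)
    moreover have "AE t in M. cmod (f t) \<le> l * (sqrt (cmod (p t)) * sqrt (cmod (q t)))"
      using fle unfolding pq by (simp add: real_sqrt_mult mult_ac)
    ultimately have "?P f \<le> ennreal (l * 1)"
      using lat l by (intro pair_norm_le[where a = p and b = q] pair_norm_klattice) auto
    thus "?P f \<le> ennreal (1 * l)" by simp
  qed simp
  thus "kdom M ?P (quad_norm M U0 V0 U1 V1)"
    unfolding kdom_def by (intro exI[of _ 1]) auto
qed

lemma kothe_pair_kdom:
  assumes "kothe M A" "kothe M B" "klattice M N" "kspace M (pair_norm M A B) \<subseteq> kspace M N"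
  shows "kdom M N (pair_norm M A B)"
  unfolding pair_norm_def using assms kothe_imp_klattice
  by (intro kspace_subset_imp_kdom) (auto simp: pair_norm_def)

section \<open>Differentials of families on arcs\<close>

lemma ennreal_mult_le_of_kdom:
  assumes "n \<le> ennreal C * P x" "P x \<le> ennreal K * W x" "K \<ge> 0" "\<bar>C\<bar> * K \<le> D"
  shows "n \<le> ennreal D * W x"
proof -
  have "n \<le> ennreal C * (ennreal K * W x)"
    using assms by (meson mult_left_mono order_trans zero_le)
  also have "\<dots> \<le> ennreal \<bar>C\<bar> * (ennreal K * W x)"
    by (intro mult_right_mono ennreal_leI) auto
  also have "\<dots> = ennreal (\<bar>C\<bar> * K) * W x"
    using assms by (simp add: ennreal_mult mult.assoc)
  also have "\<dots> \<le> ennreal D * W x"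
    using assms by (intro mult_right_mono ennreal_leI) auto
  finally show ?thesis .
qed

text \<open>In a combined factorization almost optimality is measured by the functional of the
  family, hence the restatement for any \<open>W\<close> that bounds the pair norm from
  above.\<close>

lemma pair_aof_dominated:
  assumes "pair_aof M A B a b" "kdom M (pair_norm M A B) W"
  obtains D where "D > 0" "\<And>x. x \<in> kspace M W \<Longrightarrow> a x \<in> borel_measurable M"
    "\<And>x. x \<in> kspace M W \<Longrightarrow> b x \<in> borel_measurable M"
    "\<And>x. x \<in> kspace M W \<Longrightarrow> A (a x) \<le> ennreal D * W x"
    "\<And>x. x \<in> kspace M W \<Longrightarrow> B (b x) \<le> ennreal D * W x"
    "\<And>x. x \<in> kspace M W \<Longrightarrow> AE t in M. cmod (x t) = sqrt (cmod (a x t)) * sqrt (cmod (b x t))"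
proof -
  obtain C where C: "\<And>x. x \<in> kspace M (pair_norm M A B) \<Longrightarrow>
      a x \<in> borel_measurable M \<and> b x \<in> borel_measurable M \<and>
      A (a x) \<le> ennreal C * pair_norm M A B x \<and> B (b x) \<le> ennreal C * pair_norm M A B x \<and>
      (AE t in M. cmod (x t) = sqrt (cmod (a x t)) * sqrt (cmod (b x t)))"
    using assms unfolding pair_aof_iff by blast
  obtain K where K: "K > 0" "\<And>f. f \<in> borel_measurable M \<Longrightarrow> pair_norm M A B f \<le> ennreal K * W f"
    using assms unfolding kdom_def by blast
  have sub: "x \<in> kspace M (pair_norm M A B)" if "x \<in> kspace M W" for x
    using kdom_imp_kspace_subset[OF assms(2)] that by blast
  have meas: "x \<in> borel_measurable M" if "x \<in> kspace M W" for x
    using that by (simp add: kspace_def)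
  have D: "0 < \<bar>C\<bar> * K + 1" using K by (intro add_nonneg_pos) auto
  show ?thesis
  proof (rule that[OF D])
    fix x assume x: "x \<in> kspace M W"
    show "A (a x) \<le> ennreal (\<bar>C\<bar> * K + 1) * W x"
      by (rule ennreal_mult_le_of_kdom[where P = "pair_norm M A B" and W = W and C = C, OF _ K(2)[OF meas[OF x]]])
         (use C[OF sub[OF x]] K in auto)
    show "B (b x) \<le> ennreal (\<bar>C\<bar> * K + 1) * W x"
      by (rule ennreal_mult_le_of_kdom[where P = "pair_norm M A B" and W = W and C = C, OF _ K(2)[OF meas[OF x]]])
         (use C[OF sub[OF x]] K in auto)
  qed (use C[OF sub] in auto)
qed

section \<open>Families on the four quarter arcs\<close>

lemma quad_aof:
  assumes U: "pair_aof M U0 U1 aU bU" "kdom M (pair_norm M U0 U1) (quad_norm M U0 V0 U1 V1)"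
    and V: "pair_aof M V0 V1 aV bV" "kdom M (pair_norm M V0 V1) (quad_norm M U0 V0 U1 V1)"
  shows "aof M {0..<4} (\<lambda>_. 1/4) (sel4 U0 V0 U1 V1) (sel4 aU aV bU bV)"
proof -
  let ?W = "quad_norm M U0 V0 U1 V1"
  obtain C where C: "C > 0" "\<And>x. x \<in> kspace M ?W \<Longrightarrow> aU x \<in> borel_measurable M"
    "\<And>x. x \<in> kspace M ?W \<Longrightarrow> bU x \<in> borel_measurable M"
    "\<And>x. x \<in> kspace M ?W \<Longrightarrow> U0 (aU x) \<le> ennreal C * ?W x"
    "\<And>x. x \<in> kspace M ?W \<Longrightarrow> U1 (bU x) \<le> ennreal C * ?W x"
    "\<And>x. x \<in> kspace M ?W \<Longrightarrow> AE t in M. cmod (x t) = sqrt (cmod (aU x t)) * sqrt (cmod (bU x t))"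
    by (rule pair_aof_dominated[OF U], blast)
  obtain D where D: "D > 0" "\<And>x. x \<in> kspace M ?W \<Longrightarrow> aV x \<in> borel_measurable M"
    "\<And>x. x \<in> kspace M ?W \<Longrightarrow> bV x \<in> borel_measurable M"
    "\<And>x. x \<in> kspace M ?W \<Longrightarrow> V0 (aV x) \<le> ennreal D * ?W x"
    "\<And>x. x \<in> kspace M ?W \<Longrightarrow> V1 (bV x) \<le> ennreal D * ?W x"
    "\<And>x. x \<in> kspace M ?W \<Longrightarrow> AE t in M. cmod (x t) = sqrt (cmod (aV x t)) * sqrt (cmod (bV x t))"
    by (rule pair_aof_dominated[OF V], blast)
  have le: "ennreal C * ?W x \<le> ennreal (C + D) * ?W x" "ennreal D * ?W x \<le> ennreal (C + D) * ?W x" for x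
    using C(1) D(1) by (auto intro!: mult_right_mono ennreal_leI)
  show ?thesis
    unfolding aof_def quad_norm_def[symmetric]
  proof (intro exI[of _ "C + D"] ballI conjI)
    fix x j assume x: "x \<in> kspace M ?W" and "j \<in> {0..<4::nat}"
    then consider "j = 0" | "j = 1" | "j = 2" | "j = 3" by (auto simp: atLeastLessThan_0_4)
    thus "sel4 aU aV bU bV j x \<in> borel_measurable M"
      "sel4 U0 V0 U1 V1 j (sel4 aU aV bU bV j x) \<le> ennreal (C + D) * ?W x"
      by (cases; use C(2-5)[OF x] D(2-5)[OF x] le[of x] in \<open>auto intro: order_trans\<close>)+
  next
    fix x assume x: "x \<in> kspace M ?W"
    from C(6)[OF x] D(6)[OF x]
    show "AE t in M. cmod (x t) = (\<Prod>j\<in>{0..<4}. cmod (sel4 aU aV bU bV j x t) powr (1/4))"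
    proof eventually_elim
      case (elim t)
      have "cmod (x t) = sqrt (cmod (x t)) * sqrt (cmod (x t))" by simp
      also have "\<dots> = sqrt (sqrt (cmod (aU x t)) * sqrt (cmod (bU x t))) * sqrt (sqrt (cmod (aV x t)) * sqrt (cmod (bV x t)))"
        using elim by simp
      also have "\<dots> = (\<Prod>j\<in>{0..<4}. cmod (sel4 aU aV bU bV j x t) powr (1/4))"
        by (simp add: atLeastLessThan_0_4 powr_quarter real_sqrt_mult mult_ac)
      finally show ?case .
    qed
  qed
qed

text \<open>Where \<open>x\<close> vanishes a factor may vanish too and the logarithm need not
  split, but \<open>x\<close> then annihilates both sides.\<close>

lemma times_ln_quotient:
  fixes x :: complex
  assumes "cmod x = sqrt p * sqrt q" "p \<ge> 0" "q \<ge> 0"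
  shows "x * complex_of_real (ln (q / p)) = x * (complex_of_real (ln q) - complex_of_real (ln p))"
proof (cases "x = 0")
  case False
  hence "p \<noteq> 0" "q \<noteq> 0" using assms by auto
  thus ?thesis using assms by (simp add: ln_div)
qed simp

text \<open>The pair \<open>U\<close> has the coefficients \<open>- \<i>\<close> and
  \<open>\<i>\<close>, the pair \<open>V\<close> has -1 and 1, all times \<open>dphi (A4 3)\<close>;
  this is the source of \<open>\<i>\<close> in front of the differential of \<open>U\<close>. The
  target \<open>Z\<close> is left free so that every placement can be related to the same
  norm.\<close>

lemma fam_generates_quad:
  assumes kU: "kothe M U0" "kothe M U1" and kV: "kothe M V0" "kothe M V1"
    and U: "pair_aof M U0 U1 aU bU" and V: "pair_aof M V0 V1 aV bV"
    and eqUV: "kspace M (pair_norm M U0 U1) = kspace M (pair_norm M V0 V1)"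
    and Z: "kdom M Z (pair_norm M U0 U1)" "kdom M (pair_norm M U0 U1) Z"
  shows "fam_generates M {0..<4} A4 (sel4 U0 V0 U1 V1) Z (dphi (A4 3))
      (\<lambda>x t. pair_diff aV bV x t + \<i> * pair_diff aU bU x t)"
proof -
  let ?W = "quad_norm M U0 V0 U1 V1"
  note lat = kothe_imp_klattice[OF kU(1)] kothe_imp_klattice[OF kU(2)]
    kothe_imp_klattice[OF kV(1)] kothe_imp_klattice[OF kV(2)]
  have dom: "kdom M (pair_norm M U0 U1) (pair_norm M V0 V1)" "kdom M (pair_norm M V0 V1) (pair_norm M U0 U1)"
    using kothe_pair_kdom[OF kV pair_norm_klattice[OF lat(1,2)]]
      kothe_pair_kdom[OF kU pair_norm_klattice[OF lat(3,4)]] eqUV by auto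
  have WU: "kdom M ?W (pair_norm M U0 U1)" "kdom M (pair_norm M U0 U1) ?W"
    using kdom_quad_norm[OF lat dom] by auto
  have VW: "kdom M (pair_norm M V0 V1) ?W" using kdom_trans[OF dom(2) WU(2)] .
  have WZ: "kdom M ?W Z" "kdom M Z ?W"
    using kdom_trans[OF WU(1) Z(2)] kdom_trans[OF Z(1) WU(2)] by auto
  have fam: "fam_norm M {0..<4} A4 (sel4 U0 V0 U1 V1) = ?W"
    unfolding fam_norm_def quad_norm_def by (rule calderon_cong) (simp add: mu0_A4)
  have sub: "x \<in> kspace M (pair_norm M U0 U1)" "x \<in> kspace M (pair_norm M V0 V1)" if "x \<in> kspace M ?W" for x
    using kdom_imp_kspace_subset[OF WU(2)] kdom_imp_kspace_subset[OF VW] that by auto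
  show ?thesis
    unfolding fam_generates_def fam
  proof (intro allI impI conjI)
    fix as assume "fam_aof M {0..<4} A4 (sel4 U0 V0 U1 V1) as"
    hence as: "aof M {0..<4} (\<lambda>_. 1/4) (sel4 U0 V0 U1 V1) as"
      unfolding fam_aof_def by (subst (asm) aof_cong[where \<theta>' = "\<lambda>_. 1/4"]) (simp_all add: mu0_A4)
    have bs: "aof M {0..<4} (\<lambda>_. 1/4) (sel4 U0 V0 U1 V1) (sel4 aU aV bU bV)"
      by (rule quad_aof[OF U WU(2) V VW])
    show "kspace M ?W = kspace M Z"
      using kdom_imp_kspace_subset[OF WZ(1)] kdom_imp_kspace_subset[OF WZ(2)] by auto
    have "trivial M ?W (\<lambda>x t. fam_diff {0..<4} A4 as x t - dphi (A4 3) * (pair_diff aV bV x t + \<i> * pair_diff aU bU x t))"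
      unfolding quad_norm_def
    proof (rule trivial_if_factorizations_differ[OF _ _ _ _ as bs, where \<kappa> = "\<lambda>j. dphi (A4 j)"], unfold quad_norm_def[symmetric])
      fix x assume x: "x \<in> kspace M ?W"
      have [measurable]: "fam_diff {0..<4} A4 as x \<in> borel_measurable M"
        "pair_diff aV bV x \<in> borel_measurable M" "pair_diff aU bU x \<in> borel_measurable M"
        using fam_diff_measurable[OF as] pair_aof_measurable[OF U] pair_aof_measurable[OF V] sub[OF x] x
        by (auto simp: quad_norm_def)
      show "(\<lambda>t. fam_diff {0..<4} A4 as x t - dphi (A4 3) * (pair_diff aV bV x t + \<i> * pair_diff aU bU x t)) \<in> borel_measurable M"
        by measurable
      have "AE t in M. cmod (x t) = sqrt (cmod (aU x t)) * sqrt (cmod (bU x t))"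
        "AE t in M. cmod (x t) = sqrt (cmod (aV x t)) * sqrt (cmod (bV x t))"
        using U V sub[OF x] unfolding pair_aof_iff by auto
      thus "AE t in M. fam_diff {0..<4} A4 as x t - dphi (A4 3) * (pair_diff aV bV x t + \<i> * pair_diff aU bU x t) =
         x t * (\<Sum>j\<in>{0..<4}. dphi (A4 j) *
            complex_of_real (ln (cmod (as j x t)) - ln (cmod (sel4 aU aV bU bV j x t))))"
      proof eventually_elim
        case (elim t)
        have pd: "pair_diff aU bU x t = x t * (complex_of_real (ln (cmod (bU x t))) - complex_of_real (ln (cmod (aU x t))))"
          "pair_diff aV bV x t = x t * (complex_of_real (ln (cmod (bV x t))) - complex_of_real (ln (cmod (aV x t))))"
          unfolding pair_diff_def
          by (rule times_ln_quotient[OF elim(1) norm_ge_zero norm_ge_zero] times_ln_quotient[OF elim(2) norm_ge_zero norm_ge_zero])+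
        show ?case unfolding pd
          by (simp add: fam_diff_def atLeastLessThan_0_4 dphi_A4(2-4)[simplified] algebra_simps)
      qed
    qed (use lat in \<open>auto simp: atLeastLessThan_0_4\<close>)
    thus "trivial M Z (\<lambda>x t. fam_diff {0..<4} A4 as x t - dphi (A4 3) * (pair_diff aV bV x t + \<i> * pair_diff aU bU x t))"
      by (rule trivial_transfer[OF WZ])
  qed
qed

section \<open>Families on the two half arcs\<close>

text \<open>Geometric means of corresponding factors are bounded in the intermediate products, and
  multiplying them recovers the modulus of \<open>x\<close> from its two factorizations.\<close>

lemma pair_aof_pair_norms:
  assumes lat: "klattice M X0" "klattice M X1" "klattice M Y0" "klattice M Y1"
    and X: "pair_aof M X0 X1 aX bX" "kdom M (pair_norm M X0 X1) W"
    and Y: "pair_aof M Y0 Y1 aY bY" "kdom M (pair_norm M Y0 Y1) W"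
    and W: "W = pair_norm M (pair_norm M X0 Y0) (pair_norm M X1 Y1)"
  shows "pair_aof M (pair_norm M X0 Y0) (pair_norm M X1 Y1)
     (\<lambda>x t. complex_of_real (sqrt (cmod (aX x t)) * sqrt (cmod (aY x t))))
     (\<lambda>x t. complex_of_real (sqrt (cmod (bX x t)) * sqrt (cmod (bY x t))))"
proof -
  obtain C where C: "C > 0" "\<And>x. x \<in> kspace M W \<Longrightarrow> aX x \<in> borel_measurable M"
    "\<And>x. x \<in> kspace M W \<Longrightarrow> bX x \<in> borel_measurable M"
    "\<And>x. x \<in> kspace M W \<Longrightarrow> X0 (aX x) \<le> ennreal C * W x"
    "\<And>x. x \<in> kspace M W \<Longrightarrow> X1 (bX x) \<le> ennreal C * W x"
    "\<And>x. x \<in> kspace M W \<Longrightarrow> AE t in M. cmod (x t) = sqrt (cmod (aX x t)) * sqrt (cmod (bX x t))"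
    by (rule pair_aof_dominated[OF X], blast)
  obtain D where D: "D > 0" "\<And>x. x \<in> kspace M W \<Longrightarrow> aY x \<in> borel_measurable M"
    "\<And>x. x \<in> kspace M W \<Longrightarrow> bY x \<in> borel_measurable M"
    "\<And>x. x \<in> kspace M W \<Longrightarrow> Y0 (aY x) \<le> ennreal D * W x"
    "\<And>x. x \<in> kspace M W \<Longrightarrow> Y1 (bY x) \<le> ennreal D * W x"
    "\<And>x. x \<in> kspace M W \<Longrightarrow> AE t in M. cmod (x t) = sqrt (cmod (aY x t)) * sqrt (cmod (bY x t))"
    by (rule pair_aof_dominated[OF Y], blast)
  have CD: "C + D > 0" using C(1) D(1) by simp
  have le: "ennreal C * W x \<le> ennreal (C + D) * ennreal l" "ennreal D * W x \<le> ennreal (C + D) * ennreal l"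
    if "W x < ennreal l" for x l
    using C(1) D(1) that by (auto intro!: mult_mono ennreal_leI)
  have bound: "pair_norm M A B (\<lambda>t. complex_of_real (sqrt (cmod (a t)) * sqrt (cmod (b t)))) \<le> ennreal (C + D) * W x"
    if "klattice M A" "klattice M B" "a \<in> borel_measurable M" "b \<in> borel_measurable M"
      "A a \<le> ennreal C * W x" "B b \<le> ennreal D * W x" for A B a b x
  proof (rule ennreal_le_multI[OF CD])
    fix l :: real assume l: "0 < l" "W x < ennreal l"
    have "A a \<le> ennreal ((C + D) * l)" "B b \<le> ennreal ((C + D) * l)"
      using that le[OF l(2)] l(1) CD by (auto simp: ennreal_mult intro: order_trans)
    hence "pair_norm M A B (\<lambda>t. complex_of_real (sqrt (cmod (a t)) * sqrt (cmod (b t)))) \<le> ennreal (1 * ((C + D) * l))"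
      using that l CD by (intro pair_norm_le[where a = a and b = b]) (auto simp: norm_mult)
    thus "pair_norm M A B (\<lambda>t. complex_of_real (sqrt (cmod (a t)) * sqrt (cmod (b t)))) \<le> ennreal ((C + D) * l)"
      by simp
  qed
  show ?thesis
    unfolding pair_aof_iff W[symmetric]
  proof (intro exI[of _ "C + D"] ballI conjI)
    fix x assume x: "x \<in> kspace M W"
    note [measurable] = C(2,3)[OF x] D(2,3)[OF x]
    show "(\<lambda>t. complex_of_real (sqrt (cmod (aX x t)) * sqrt (cmod (aY x t)))) \<in> borel_measurable M"
      "(\<lambda>t. complex_of_real (sqrt (cmod (bX x t)) * sqrt (cmod (bY x t)))) \<in> borel_measurable M"
      by measurable
    show "pair_norm M X0 Y0 (\<lambda>t. complex_of_real (sqrt (cmod (aX x t)) * sqrt (cmod (aY x t)))) \<le> ennreal (C + D) * W x"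
      using lat C(2,4)[OF x] D(2,4)[OF x] by (intro bound) auto
    show "pair_norm M X1 Y1 (\<lambda>t. complex_of_real (sqrt (cmod (bX x t)) * sqrt (cmod (bY x t)))) \<le> ennreal (C + D) * W x"
      using lat C(3,5)[OF x] D(3,5)[OF x] by (intro bound) auto
    from C(6)[OF x] D(6)[OF x]
    show "AE t in M. cmod (x t) =
       sqrt (cmod (complex_of_real (sqrt (cmod (aX x t)) * sqrt (cmod (aY x t))))) *
       sqrt (cmod (complex_of_real (sqrt (cmod (bX x t)) * sqrt (cmod (bY x t)))))"
    proof eventually_elim
      case (elim t)
      have "cmod (x t) = sqrt (cmod (x t)) * sqrt (cmod (x t))" by simp
      also have "\<dots> = sqrt (sqrt (cmod (aX x t)) * sqrt (cmod (bX x t))) * sqrt (sqrt (cmod (aY x t)) * sqrt (cmod (bY x t)))"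
        using elim by simp
      finally show ?case by (simp add: norm_mult real_sqrt_mult mult_ac)
    qed
  qed
qed

lemma proj_equiv_sum:
  assumes kX: "kothe M X0" "kothe M X1" and kY: "kothe M Y0" "kothe M Y1"
    and X: "pair_aof M X0 X1 aX bX" and Y: "pair_aof M Y0 Y1 aY bY"
    and eqXY: "kspace M (pair_norm M X0 X1) = kspace M (pair_norm M Y0 Y1)"
    and fa: "fam_aof M {0::nat, 1} A2 (\<lambda>j. if j = 0 then pair_norm M X0 Y0 else pair_norm M X1 Y1) as"
  shows "kspace M (fam_norm M {0::nat, 1} A2
              (\<lambda>j. if j = 0 then pair_norm M X0 Y0 else pair_norm M X1 Y1)) = kspace M (pair_norm M X0 X1)"
    and "proj_equiv M (pair_norm M X0 X1)
         (\<lambda>x t. pair_diff aX bX x t + pair_diff aY bY x t) (fam_diff {0::nat, 1} A2 as)"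
proof -
  let ?Z = "pair_norm M X0 X1"
  define W where "W = pair_norm M (pair_norm M X0 Y0) (pair_norm M X1 Y1)"
  note lat = kothe_imp_klattice[OF kX(1)] kothe_imp_klattice[OF kX(2)]
    kothe_imp_klattice[OF kY(1)] kothe_imp_klattice[OF kY(2)]
  have dom: "kdom M ?Z (pair_norm M Y0 Y1)" "kdom M (pair_norm M Y0 Y1) ?Z"
    using kothe_pair_kdom[OF kY pair_norm_klattice[OF lat(1,2)]]
      kothe_pair_kdom[OF kX pair_norm_klattice[OF lat(3,4)]] eqXY by auto
  have WZ: "kdom M W ?Z" "kdom M ?Z W"
    using kdom_trans[OF kdom_pair_norm_pair_norm(2)[OF lat] kdom_quad_norm(1)[OF lat dom]]
      kdom_trans[OF kdom_quad_norm(2)[OF lat dom] kdom_pair_norm_pair_norm(1)[OF lat]]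
    by (auto simp: W_def)
  have YW: "kdom M (pair_norm M Y0 Y1) W" by (rule kdom_trans[OF dom(2) WZ(2)])
  have fam: "fam_norm M {0::nat, 1} A2 (\<lambda>j. if j = 0 then pair_norm M X0 Y0 else pair_norm M X1 Y1) = W"
    unfolding fam_norm_def W_def pair_norm_def[of M "pair_norm M X0 Y0"]
    by (rule calderon_cong) (auto simp: mu0_A2)
  show "kspace M (fam_norm M {0::nat, 1} A2
              (\<lambda>j. if j = 0 then pair_norm M X0 Y0 else pair_norm M X1 Y1)) = kspace M ?Z"
    unfolding fam using kdom_imp_kspace_subset[OF WZ(1)] kdom_imp_kspace_subset[OF WZ(2)] by auto
  have sub: "x \<in> kspace M ?Z" "x \<in> kspace M (pair_norm M Y0 Y1)" if "x \<in> kspace M W" for x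
    using kdom_imp_kspace_subset[OF WZ(2)] kdom_imp_kspace_subset[OF YW] that by auto
  have as: "aof M {0::nat, 1} (\<lambda>_. 1/2) (\<lambda>j. if j = 0 then pair_norm M X0 Y0 else pair_norm M X1 Y1) as"
    using fa unfolding fam_aof_def by (subst (asm) aof_cong[where \<theta>' = "\<lambda>_. 1/2"]) (auto simp: mu0_A2)
  let ?a = "\<lambda>x t. complex_of_real (sqrt (cmod (aX x t)) * sqrt (cmod (aY x t)))"
  let ?b = "\<lambda>x t. complex_of_real (sqrt (cmod (bX x t)) * sqrt (cmod (bY x t)))"
  have bs: "aof M {0::nat, 1} (\<lambda>_. 1/2) (\<lambda>j. if j = 0 then pair_norm M X0 Y0 else pair_norm M X1 Y1)
      (\<lambda>j. if j = 0 then ?a else ?b)"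
    using pair_aof_pair_norms[OF lat X WZ(2) Y YW W_def] unfolding pair_aof_def .
  \<comment> \<open>The constant \<open>- \<i> * pi\<close> turns the coefficients of the half arcs
    into -2 and 2. The 2 undoes the square root in the geometric means, whose logarithms are half
    the sums of the logarithms for the two pairs.\<close>
  have "trivial M W (\<lambda>x t. pair_diff aX bX x t + pair_diff aY bY x t - (- \<i> * pi) * fam_diff {0::nat, 1} A2 as x t)"
    unfolding W_def pair_norm_def[of M "pair_norm M X0 Y0"]
  proof (rule trivial_if_factorizations_differ[OF _ _ _ _ as bs, where \<kappa> = "\<lambda>j. if j = 0 then 2 else - 2"],
      unfold pair_norm_def[of M "pair_norm M X0 Y0", symmetric] W_def[symmetric])
    fix x assume x: "x \<in> kspace M W"
    have [measurable]: "fam_diff {0::nat, 1} A2 as x \<in> borel_measurable M"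
      "pair_diff aX bX x \<in> borel_measurable M" "pair_diff aY bY x \<in> borel_measurable M"
      using fam_diff_measurable[OF as, of x] pair_aof_measurable[OF X sub(1)[OF x]]
        pair_aof_measurable[OF Y sub(2)[OF x]] x
      by (auto simp: W_def pair_norm_def[of M "pair_norm M X0 Y0"])
    show "(\<lambda>t. pair_diff aX bX x t + pair_diff aY bY x t - (- \<i> * pi) * fam_diff {0::nat, 1} A2 as x t) \<in> borel_measurable M"
      by measurable
    have "AE t in M. cmod (x t) = sqrt (cmod (aX x t)) * sqrt (cmod (bX x t))"
      "AE t in M. cmod (x t) = sqrt (cmod (aY x t)) * sqrt (cmod (bY x t))"
      using X Y sub[OF x] unfolding pair_aof_iff by auto
    thus "AE t in M. pair_diff aX bX x t + pair_diff aY bY x t - (- \<i> * pi) * fam_diff {0::nat, 1} A2 as x t =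
       x t * (\<Sum>j\<in>{0::nat, 1}. (if j = 0 then 2 else - 2) *
          complex_of_real (ln (cmod (as j x t)) - ln (cmod ((if j = 0 then ?a else ?b) x t))))"
    proof eventually_elim
      case (elim t)
      have f: "(- \<i> * pi) * fam_diff {0::nat, 1} A2 as x t
          = x t * (2 * complex_of_real (ln (cmod (as 1 x t))) - 2 * complex_of_real (ln (cmod (as 0 x t))))"
        by (simp add: fam_diff_def dphi_A2[simplified] field_simps)
      have X': "pair_diff aX bX x t = x t * (complex_of_real (ln (cmod (bX x t))) - complex_of_real (ln (cmod (aX x t))))"
        and Y': "pair_diff aY bY x t = x t * (complex_of_real (ln (cmod (bY x t))) - complex_of_real (ln (cmod (aY x t))))"
        unfolding pair_diff_def
          by (rule times_ln_quotient[OF elim(1) norm_ge_zero norm_ge_zero] times_ln_quotient[OF elim(2) norm_ge_zero norm_ge_zero])+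
      show ?case
      \<comment> \<open>Splitting the logarithm of a geometric mean requires nonzero factors, which
        a nonzero value of \<open>x\<close> guarantees.\<close>
      proof (cases "x t = 0")
        case True
        thus ?thesis unfolding f X' Y' by simp
      next
        case False
        hence "aX x t \<noteq> 0" "bX x t \<noteq> 0" "aY x t \<noteq> 0" "bY x t \<noteq> 0" using elim by auto
        hence "2 * ln (cmod (?a x t)) = ln (cmod (aX x t)) + ln (cmod (aY x t))"
          "2 * ln (cmod (?b x t)) = ln (cmod (bX x t)) + ln (cmod (bY x t))"
          by (simp_all add: norm_mult ln_mult ln_sqrt)
        hence ab: "2 * complex_of_real (ln (cmod (?a x t))) = complex_of_real (ln (cmod (aX x t))) + complex_of_real (ln (cmod (aY x t)))"
          "2 * complex_of_real (ln (cmod (?b x t))) = complex_of_real (ln (cmod (bX x t))) + complex_of_real (ln (cmod (bY x t)))"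
          by (metis of_real_add of_real_mult of_real_numeral)+
        have S: "(\<Sum>j\<in>{0::nat, 1}. (if j = 0 then 2 else - 2) *
          complex_of_real (ln (cmod (as j x t)) - ln (cmod ((if j = 0 then ?a else ?b) x t))))
          = 2 * complex_of_real (ln (cmod (as 0 x t))) - 2 * complex_of_real (ln (cmod (as 1 x t)))
            + 2 * complex_of_real (ln (cmod (?b x t))) - 2 * complex_of_real (ln (cmod (?a x t)))"
          by (simp add: algebra_simps)
        show ?thesis unfolding f X' Y' S ab by (simp add: algebra_simps)
      qed
    qed
  qed (use lat in \<open>auto simp: pair_norm_klattice\<close>)
  hence "trivial M ?Z (\<lambda>x t. pair_diff aX bX x t + pair_diff aY bY x t - (- \<i> * pi) * fam_diff {0::nat, 1} A2 as x t)"
    by (rule trivial_transfer[OF WZ])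
  thus "proj_equiv M ?Z (\<lambda>x t. pair_diff aX bX x t + pair_diff aY bY x t) (fam_diff {0::nat, 1} A2 as)"
    unfolding proj_equiv_def by (intro exI[of _ "- \<i> * pi"]) auto
qed

theorem mainTheorem6:
  fixes M :: "'a measure" and X0 X1 Y0 Y1 :: "'a knorm"
    and aX bX aY bY :: "'a kfun \<Rightarrow> 'a kfun"
  assumes "sigma_finite_measure M"
    and "kothe M X0" "kothe M X1" "kothe M Y0" "kothe M Y1"
    and "regular_pair M X0 X1" "regular_pair M Y0 Y1"
    and "kspace M (pair_norm M X0 X1) = kspace M (pair_norm M Y0 Y1)"
    and "pair_aof M X0 X1 aX bX" "pair_aof M Y0 Y1 aY bY"
  shows
   "dphi (A4 3) \<noteq> 0 \<and>
    fam_generates M {0..<4} A4 (sel4 Y0 X0 Y1 X1) (pair_norm M X0 X1) (dphi (A4 3))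
      (\<lambda>x t. pair_diff aX bX x t + \<i> * pair_diff aY bY x t) \<and>
    fam_generates M {0..<4} A4 (sel4 Y1 X0 Y0 X1) (pair_norm M X0 X1) (dphi (A4 3))
      (\<lambda>x t. pair_diff aX bX x t - \<i> * pair_diff aY bY x t) \<and>
    fam_generates M {0..<4} A4 (sel4 Y0 X1 Y1 X0) (pair_norm M X0 X1) (dphi (A4 3))
      (\<lambda>x t. - pair_diff aX bX x t + \<i> * pair_diff aY bY x t) \<and>
    fam_generates M {0..<4} A4 (sel4 Y1 X1 Y0 X0) (pair_norm M X0 X1) (dphi (A4 3))
      (\<lambda>x t. - pair_diff aX bX x t - \<i> * pair_diff aY bY x t) \<and>
    fam_generates M {0..<4} A4 (sel4 X0 Y0 X1 Y1) (pair_norm M X0 X1) (dphi (A4 3))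
      (\<lambda>x t. \<i> * pair_diff aX bX x t + pair_diff aY bY x t) \<and>
    (\<forall>as. fam_aof M {0::nat, 1} A2
              (\<lambda>j. if j = 0 then pair_norm M X0 Y0 else pair_norm M X1 Y1) as \<longrightarrow>
       kspace M (fam_norm M {0::nat, 1} A2
              (\<lambda>j. if j = 0 then pair_norm M X0 Y0 else pair_norm M X1 Y1)) = kspace M (pair_norm M X0 X1) \<and>
       proj_equiv M (pair_norm M X0 X1)
         (\<lambda>x t. pair_diff aX bX x t + pair_diff aY bY x t)
         (fam_diff {0::nat, 1} A2 as))"
proof -
  note k = assms(2-5)
  note eq = assms(8)
  note X = assms(9) and Y = assms(10)
  note X' = pair_aof_commute[OF X] and Y' = pair_aof_commute[OF Y]
  let ?Z = "pair_norm M X0 X1"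
  \<comment> \<open>The target norm is always that of the pair \<open>X\<close>. Placements with the
    pair \<open>Y\<close> on the first and third arcs need the equivalence of the two norms, which
    the equality of the spaces yields in both directions.\<close>
  have YZ: "kdom M (pair_norm M Y0 Y1) ?Z" "kdom M ?Z (pair_norm M Y0 Y1)"
    using kothe_pair_kdom[OF k(1,2) pair_norm_klattice[OF k(3,4)[THEN kothe_imp_klattice]]]
      kothe_pair_kdom[OF k(3,4) pair_norm_klattice[OF k(1,2)[THEN kothe_imp_klattice]]] eq by auto
  have ZZ: "kdom M ?Z ?Z" unfolding kdom_def by (intro exI[of _ 1]) simp
  note comm = pair_norm_commute[of M X1 X0] pair_norm_commute[of M Y1 Y0]
  have 1: "fam_generates M {0..<4} A4 (sel4 Y0 X0 Y1 X1) ?Z (dphi (A4 3))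
      (\<lambda>x t. pair_diff aX bX x t + \<i> * pair_diff aY bY x t)"
    by (rule fam_generates_quad[OF k(3,4,1,2) Y X eq[symmetric] YZ(2,1)])
  \<comment> \<open>A swap inside a pair leaves its product norm unchanged and reverses the sign of
    its differential; the sign is restored when the swapped differentials are rewritten at the
    end.\<close>
  have 2: "fam_generates M {0..<4} A4 (sel4 Y1 X0 Y0 X1) ?Z (dphi (A4 3))
      (\<lambda>x t. pair_diff aX bX x t + \<i> * pair_diff bY aY x t)"
    by (rule fam_generates_quad[OF k(4,3,1,2) Y' X]) (simp_all add: comm eq YZ)
  have 3: "fam_generates M {0..<4} A4 (sel4 Y0 X1 Y1 X0) ?Z (dphi (A4 3))
      (\<lambda>x t. pair_diff bX aX x t + \<i> * pair_diff aY bY x t)"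
    by (rule fam_generates_quad[OF k(3,4,2,1) Y X']) (simp_all add: comm eq YZ)
  have 4: "fam_generates M {0..<4} A4 (sel4 Y1 X1 Y0 X0) ?Z (dphi (A4 3))
      (\<lambda>x t. pair_diff bX aX x t + \<i> * pair_diff bY aY x t)"
    by (rule fam_generates_quad[OF k(4,3,2,1) Y' X']) (simp_all add: comm eq YZ)
  have 5: "fam_generates M {0..<4} A4 (sel4 X0 Y0 X1 Y1) ?Z (dphi (A4 3))
      (\<lambda>x t. pair_diff aY bY x t + \<i> * pair_diff aX bX x t)"
    by (rule fam_generates_quad[OF k X Y eq ZZ ZZ])
  have "dphi (A4 3) \<noteq> 0"
    unfolding dphi_A4(1) by (simp add: complex_eq_iff)
  with 1 2 3 4 5 proj_equiv_sum[OF k X Y eq] show ?thesis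
    by (simp add: pair_diff_commute[of bX aX] pair_diff_commute[of bY aY] add.commute)
qed

end
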